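(* Fix an o-minimal structure $\mathcal{S}$ over $\mathbb{R}$ that contains all semialgebraic sets. Let $m,n$ be positive integers, let $Z\subseteq \mathbb{R}^{m+n}$ be a definable family such that the fibers $Z_T=\{x\in\mathbb{R}^n:(T,x)\in Z\}$ are bounded for all $T\in\mathbb{R}^m$, and let $j$ be an integer such that $0\leq j\leq n-1$. Then there exists a constant $B_Z$, depending only on the family $Z$ and on $j$, such that $$V_j'(\mathrm{cl}(Z_T))\leq B_Z\, V_j(Z_T)$$ for every $T \in \mathbb{R}^m$.
   Context: An o-minimal structure (over $\mathbb{R}$) is a sequence $\mathcal{S}=(\mathcal{S}_n)_{n\geq 1}$, where $\mathcal{S}_n$ is a family of subsets of $\mathbb{R}^n$, such that for each $n$: (1) $\emptyset\in\mathcal{S}_n$ and $\mathcal{S}_n$ is closed under finite unions and complements in $\mathbb{R}^n$; (2) if $A\in\mathcal{S}_n$ then $\mathbb{R}\times A\in\mathcal{S}_{n+1}$ and $A\times\mathbb{R}\in\mathcal{S}_{n+1}$; (3) $\{(x_1,\ldots,x_n):x_i=x_j\}\in\mathcal{S}_n$ for $1\leq i<j\leq n$; (4) if $\pi:\mathbb{R}^{n+1}\to\mathbb{R}^n$ is the projection on the first $n$ coordinates and $A\in\mathcal{S}_{n+1}$, then $\pi(A)\in\mathcal{S}_n$; (5) $\{r\}\in\mathcal{S}_1$ for every $r\in\mathbb{R}$ and $\{(x,y)\in\mathbb{R}^2:x<y\}\in\mathcal{S}_2$; (6) the only sets in $\mathcal{S}_1$ are the finite unions of open intervals (infinite endpoints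 allowed) and points. A set is definable if it lies in some $\mathcal{S}_n$. A definable set $Z\subseteq\mathbb{R}^{m+n}$ is also called a definable family. $\mathrm{cl}(A)$ is the topological closure of $A$. For $0<j<n$ and a bounded definable set $A\subseteq\mathbb{R}^n$, $V_j(A)$ is the sum of the $j$-dimensional volumes of the orthogonal projections of $A$ onto all $j$-dimensional coordinate subspaces of $\mathbb{R}^n$, and $V_0(A)=1$. For a compact set $D\subseteq\mathbb{R}^n$ and $0<j<n$, $V_j'(D)$ is the supremum of the $j$-dimensional volumes of the orthogonal projections of $D$ to arbitrary $j$-dimensional linear subspaces of $\mathbb{R}^n$, and $V'_0(D)=1$. *)

theory Defs
  imports "HOL-Analysis.Analysis" "HOL-Library.Function_Algebras"
begin

text \<open>
  Points of \<open>\<real>\<^sup>n\<close> are functions \<open>nat \<Rightarrow> real\<close> vanishing from index \<open>n\<close> on, the carrier of the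
  library topology \<^const>\<open>Euclidean_space\<close>; coordinates are numbered from \<open>0\<close>.
  The pointwise vector space structure on functions makes the library notions
  \<^const>\<open>subspace\<close>, \<^const>\<open>span\<close> and \<^const>\<open>dim\<close> available.
\<close>

instantiation "fun" :: (type, real_vector) real_vector
begin

definition scaleR_fun :: "real \<Rightarrow> ('a \<Rightarrow> 'b) \<Rightarrow> 'a \<Rightarrow> 'b"
  where "scaleR_fun c f = (\<lambda>x. c *\<^sub>R f x)"

instance
  by standard (auto simp: scaleR_fun_def fun_eq_iff scaleR_add_right scaleR_add_left)

end

abbreviation Rn :: "nat \<Rightarrow> (nat \<Rightarrow> real) set"
  where "Rn n \<equiv> topspace (Euclidean_space n)"

text \<open>The point \<open>(T, x)\<close> of \<open>\<real>\<^bsup>m+n\<^esup>\<close> for \<open>T\<close> in \<open>\<real>\<^sup>m\<close> and \<open>x\<close> in \<open>\<real>\<^sup>n\<close>.\<close>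

definition join :: "nat \<Rightarrow> (nat \<Rightarrow> real) \<Rightarrow> (nat \<Rightarrow> real) \<Rightarrow> nat \<Rightarrow> real"
  where "join m T x = (\<lambda>i. if i < m then T i else x (i - m))"

definition fiber :: "nat \<Rightarrow> nat \<Rightarrow> (nat \<Rightarrow> real) set \<Rightarrow> (nat \<Rightarrow> real) \<Rightarrow> (nat \<Rightarrow> real) set"
  where "fiber m n Z T = {x \<in> Rn n. join m T x \<in> Z}"

text \<open>The library predicate \<^const>\<open>bounded\<close> cannot be used here: on the type \<open>nat \<Rightarrow> real\<close> it refers
  to a bounded metric inducing the product topology.\<close>

definition bounded_Rn :: "nat \<Rightarrow> (nat \<Rightarrow> real) set \<Rightarrow> bool"
  where "bounded_Rn n A \<longleftrightarrow> (\<exists>r. \<forall>x\<in>A. L2_set x {..<n} \<le> r)"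

definition inner_Rn :: "nat \<Rightarrow> (nat \<Rightarrow> real) \<Rightarrow> (nat \<Rightarrow> real) \<Rightarrow> real"
  where "inner_Rn n x y = (\<Sum>i<n. x i * y i)"


text \<open>Semialgebraic sets: the Boolean algebra generated by polynomial equations and inequalities.\<close>

inductive polynomial_on_Rn :: "nat \<Rightarrow> ((nat \<Rightarrow> real) \<Rightarrow> real) \<Rightarrow> bool" for n
  where
    const: "polynomial_on_Rn n (\<lambda>x. c)"
  | coord: "i < n \<Longrightarrow> polynomial_on_Rn n (\<lambda>x. x i)"
  | add: "polynomial_on_Rn n p \<Longrightarrow> polynomial_on_Rn n q \<Longrightarrow> polynomial_on_Rn n (\<lambda>x. p x + q x)"
  | mult: "polynomial_on_Rn n p \<Longrightarrow> polynomial_on_Rn n q \<Longrightarrow> polynomial_on_Rn n (\<lambda>x. p x * q x)"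

inductive semialgebraic :: "nat \<Rightarrow> (nat \<Rightarrow> real) set \<Rightarrow> bool" for n
  where
    eq: "polynomial_on_Rn n p \<Longrightarrow> semialgebraic n {x \<in> Rn n. p x = 0}"
  | gt: "polynomial_on_Rn n p \<Longrightarrow> semialgebraic n {x \<in> Rn n. p x > 0}"
  | Un: "semialgebraic n A \<Longrightarrow> semialgebraic n B \<Longrightarrow> semialgebraic n (A \<union> B)"
  | compl: "semialgebraic n A \<Longrightarrow> semialgebraic n (Rn n - A)"


definition open_interval_or_point :: "real set \<Rightarrow> bool"
  where "open_interval_or_point J \<longleftrightarrow>
    (\<exists>a b :: ereal. J = {x. a < ereal x \<and> ereal x < b}) \<or> (\<exists>r. J = {r})"

text \<open>Only \<open>S n\<close> for \<open>n \<ge> 1\<close> is constrained; \<open>S 0\<close> is irrelevant.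
  In \<open>cylinder_left\<close>, \<open>x \<circ> Suc\<close> drops the first coordinate; in \<open>cylinder_right\<close> and
  \<open>projection\<close>, \<open>x(n := 0)\<close> drops the last coordinate of \<open>x\<close> in \<open>\<real>\<^bsup>n+1\<^esup>\<close>.\<close>

locale o_minimal_structure =
  fixes S :: "nat \<Rightarrow> (nat \<Rightarrow> real) set set"
  assumes carrier: "n \<ge> 1 \<Longrightarrow> A \<in> S n \<Longrightarrow> A \<subseteq> Rn n"
    and empty: "n \<ge> 1 \<Longrightarrow> {} \<in> S n"
    and union: "n \<ge> 1 \<Longrightarrow> A \<in> S n \<Longrightarrow> B \<in> S n \<Longrightarrow> A \<union> B \<in> S n"
    and complement: "n \<ge> 1 \<Longrightarrow> A \<in> S n \<Longrightarrow> Rn n - A \<in> S n"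
    and cylinder_left: "n \<ge> 1 \<Longrightarrow> A \<in> S n \<Longrightarrow> {x \<in> Rn (n + 1). x \<circ> Suc \<in> A} \<in> S (n + 1)"
    and cylinder_right: "n \<ge> 1 \<Longrightarrow> A \<in> S n \<Longrightarrow> {x \<in> Rn (n + 1). x(n := 0) \<in> A} \<in> S (n + 1)"
    and diagonal: "n \<ge> 1 \<Longrightarrow> i < j \<Longrightarrow> j < n \<Longrightarrow> {x \<in> Rn n. x i = x j} \<in> S n"
    and projection: "n \<ge> 1 \<Longrightarrow> A \<in> S (n + 1) \<Longrightarrow> (\<lambda>x. x(n := 0)) ` A \<in> S n"
    and singleton: "{x \<in> Rn 1. x 0 = r} \<in> S 1"
    and less: "{x \<in> Rn 2. x 0 < x 1} \<in> S 2"
    and tame: "A \<in> S 1 \<Longrightarrow>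
      \<exists>F. finite F \<and> (\<forall>J\<in>F. open_interval_or_point J) \<and> A = {x \<in> Rn 1. x 0 \<in> \<Union>F}"


text \<open>Lebesgue measure on \<open>\<real>\<^sup>I\<close> for a finite index set \<open>I\<close>.\<close>

definition lebesgue_PiM :: "nat set \<Rightarrow> (nat \<Rightarrow> real) measure"
  where "lebesgue_PiM I = completion (\<Pi>\<^sub>M i\<in>I. lborel)"

text \<open>The coordinate subspace spanned by the axes in \<open>I\<close> is identified with \<open>\<real>\<^sup>I\<close>, so that the
  orthogonal projection onto it is restriction to \<open>I\<close>.\<close>

definition V :: "nat \<Rightarrow> nat \<Rightarrow> (nat \<Rightarrow> real) set \<Rightarrow> ennreal"
  where "V n j A = (if j = 0 then 1
    else \<Sum>I | I \<subseteq> {..<n} \<and> card I = j. emeasure (lebesgue_PiM I) ((\<lambda>x. restrict x I) ` A))"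

definition orth_proj :: "nat \<Rightarrow> (nat \<Rightarrow> real) set \<Rightarrow> (nat \<Rightarrow> real) \<Rightarrow> nat \<Rightarrow> real"
  where "orth_proj n W x = (THE y. y \<in> W \<and> (\<forall>w\<in>W. inner_Rn n (x - y) w = 0))"

definition orthonormal_basis :: "nat \<Rightarrow> (nat \<Rightarrow> real) set \<Rightarrow> (nat \<Rightarrow> nat \<Rightarrow> real) \<Rightarrow> bool"
  where "orthonormal_basis n W b \<longleftrightarrow>
    (\<forall>k<dim W. \<forall>l<dim W. inner_Rn n (b k) (b l) = (if k = l then 1 else 0)) \<and>
    span (b ` {..<dim W}) = W"

text \<open>The \<open>dim W\<close>-dimensional volume of a subset \<open>E\<close> of a linear subspace \<open>W\<close> of \<open>\<real>\<^sup>n\<close> is the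
  Lebesgue measure of its image under an isometry of \<open>W\<close> with \<open>\<real>\<^bsup>dim W\<^esup>\<close>. Since Lebesgue measure
  is invariant under orthogonal maps, the choice of the orthonormal basis does not matter.\<close>

definition subspace_volume :: "nat \<Rightarrow> (nat \<Rightarrow> real) set \<Rightarrow> (nat \<Rightarrow> real) set \<Rightarrow> ennreal"
  where "subspace_volume n W E =
    (let b = (SOME b. orthonormal_basis n W b)
     in emeasure (lebesgue_PiM {..<dim W}) ((\<lambda>y. \<lambda>k\<in>{..<dim W}. inner_Rn n y (b k)) ` E))"

definition V' :: "nat \<Rightarrow> nat \<Rightarrow> (nat \<Rightarrow> real) set \<Rightarrow> ennreal"
  where "V' n j D = (if j = 0 then 1
    else SUP W\<in>{W. W \<subseteq> Rn n \<and> subspace W \<and> dim W = j}. subspace_volume n W (orth_proj n W ` D))"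

end

theory Submission
  imports Defs
begin

text \<open>
  The proof avoids cell decomposition, definable choice and the area formula.

  In dimension one, a linear image of \<open>E \<subseteq> \<real>\<^sup>n\<close> whose coordinate projections consist of at most \<open>N\<close>
  intervals is small when the projections are: \<open>E\<close> is covered by a bounded number of boxes, each with
  sides no longer than the measures of the projections. For \<open>j\<close> linear functionals, Fubini over the
  remaining \<open>j - 1\<close> of them reduces the replacement of one functional by the coordinates to this
  case, so that after \<open>j\<close> replacements only coordinate projections are left. The number of intervals
  is bounded uniformly in all parameters.

  Uniform finiteness is proved by induction on the number of parameters. Over \<open>\<real>\<close> a definable subset
  of the line that is covered by countably many frontiers of definable sets is finite; hence along
  each line in parameter space the fiber cardinality is constant off a finite definable set, and
  it suffices to sample it at finitely many points that depend definably on the other parameters.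

  Closures and measurability are harmless because definable sets have null frontier, again by
  Fubini and a countable union over boxes with rational sides.
\<close>

section \<open>Definable sets\<close>

lemma Rn_iff: "x \<in> Rn n \<longleftrightarrow> (\<forall>i\<ge>n. x i = 0)"
  by (simp add: topspace_Euclidean_space)

lemma Rn_upd: "x \<in> Rn n \<Longrightarrow> i < n \<Longrightarrow> x(i := u) \<in> Rn n"
  by (auto simp: Rn_iff)

lemma Rn_upd_Suc: "x \<in> Rn n \<Longrightarrow> x(n := u) \<in> Rn (Suc n)"
  by (auto simp: Rn_iff)

lemma Rn_Suc_upd: "x \<in> Rn (Suc n) \<Longrightarrow> x(n := 0) \<in> Rn n"
  by (auto simp: Rn_iff)

lemma polynomial_diff:
  assumes "polynomial_on_Rn n p" "polynomial_on_Rn n q"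
  shows "polynomial_on_Rn n (\<lambda>x. p x - q x)"
proof -
  have "polynomial_on_Rn n (\<lambda>x. p x + (-1) * q x)"
    by (intro polynomial_on_Rn.intros assms)
  then show ?thesis by simp
qed

lemma polynomial_sum:
  assumes "\<And>i. i \<in> I \<Longrightarrow> polynomial_on_Rn n (p i)"
  shows "polynomial_on_Rn n (\<lambda>x. \<Sum>i\<in>I. p i x)"
  using assms
  by (induction I rule: infinite_finite_induct) (auto intro: polynomial_on_Rn.intros)

lemma polynomial_lift:
  assumes "polynomial_on_Rn n p"
  shows "polynomial_on_Rn (n + k) (\<lambda>w. p (\<lambda>i. if i < n then w i else 0))"
  using assms by induction (auto intro: polynomial_on_Rn.intros)

lemma polynomial_tail:
  assumes "polynomial_on_Rn n p"
  shows "polynomial_on_Rn (k + n) (\<lambda>w. p (\<lambda>i. w (k + i)))"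
  using assms by induction (auto intro: polynomial_on_Rn.intros)

lemma polynomial_if:
  "(c \<Longrightarrow> polynomial_on_Rn n p) \<Longrightarrow> (\<not> c \<Longrightarrow> polynomial_on_Rn n q) \<Longrightarrow>
    polynomial_on_Rn n (\<lambda>x. if c then p x else q x)"
  by (cases c) simp_all

lemma polynomial_upd:
  "polynomial_on_Rn n h \<Longrightarrow> polynomial_on_Rn n (\<lambda>x. G x i) \<Longrightarrow>
    polynomial_on_Rn n (\<lambda>x. ((G x)(a := h x)) i)"
  by (cases "i = a") simp_all

lemmas polynomial_intros = polynomial_on_Rn.intros polynomial_diff polynomial_sum polynomial_if
  polynomial_upd

section \<open>First-order formulas over the structure\<close>

locale semialgebraic_o_minimal = o_minimal_structure +
  assumes semialgebraic_mem: "n \<ge> 1 \<Longrightarrow> semialgebraic n A \<Longrightarrow> A \<in> S n"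
begin

text \<open>Predicates instead of sets let formulas be treated by introduction rules, connective by
  connective. Positivity of \<open>n\<close> is built in because \<open>S 0\<close> is
  unconstrained.\<close>

definition definable :: "nat \<Rightarrow> ((nat \<Rightarrow> real) \<Rightarrow> bool) \<Rightarrow> bool"
  where "definable n P \<longleftrightarrow> n > 0 \<and> {x \<in> Rn n. P x} \<in> S n"

lemma definable_cong: "(\<And>x. x \<in> Rn n \<Longrightarrow> P x \<longleftrightarrow> Q x) \<Longrightarrow> definable n P \<longleftrightarrow> definable n Q"
  unfolding definable_def by (metis (mono_tags, lifting) Collect_cong)

lemma definable_not:
  assumes "definable n P"
  shows "definable n (\<lambda>x. \<not> P x)"
proof -
  have "{x \<in> Rn n. \<not> P x} = Rn n - {x \<in> Rn n. P x}" by auto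
  then show ?thesis using assms complement[of n] unfolding definable_def by simp
qed

lemma definable_disj:
  assumes "definable n P" "definable n Q"
  shows "definable n (\<lambda>x. P x \<or> Q x)"
proof -
  have "{x \<in> Rn n. P x \<or> Q x} = {x \<in> Rn n. P x} \<union> {x \<in> Rn n. Q x}" by auto
  then show ?thesis using assms union[of n] unfolding definable_def by simp
qed

lemma definable_conj:
  assumes "definable n P" "definable n Q"
  shows "definable n (\<lambda>x. P x \<and> Q x)"
  using definable_not[OF definable_disj[OF definable_not[OF assms(1)] definable_not[OF assms(2)]]]
  by simp

lemma definable_imp:
  assumes "definable n P" "definable n Q"
  shows "definable n (\<lambda>x. P x \<longrightarrow> Q x)"
  using definable_disj[OF definable_not[OF assms(1)] assms(2)] by (simp only: imp_conv_disj)

lemma definable_False: "0 < n \<Longrightarrow> definable n (\<lambda>x. False)"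
  using empty[of n] by (simp add: definable_def)

lemma definable_True: "0 < n \<Longrightarrow> definable n (\<lambda>x. True)"
  using definable_not[OF definable_False, of n] by simp

lemma definable_finite_ball:
  assumes "finite I" "0 < n" "\<And>i. i \<in> I \<Longrightarrow> definable n (P i)"
  shows "definable n (\<lambda>x. \<forall>i\<in>I. P i x)"
  using assms by (induction I rule: finite_induct) (simp_all add: definable_True definable_conj)

lemma definable_finite_bex:
  assumes "finite I" "0 < n" "\<And>i. i \<in> I \<Longrightarrow> definable n (P i)"
  shows "definable n (\<lambda>x. \<exists>i\<in>I. P i x)"
  using assms by (induction I rule: finite_induct) (simp_all add: definable_False definable_disj)

lemma definable_less:
  assumes "0 < n" "polynomial_on_Rn n p" "polynomial_on_Rn n q"
  shows "definable n (\<lambda>x. p x < q x)"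
  using semialgebraic_mem[OF _ semialgebraic.gt[OF polynomial_diff[OF assms(3,2)]]] assms(1)
  by (simp add: definable_def)

lemma definable_eq:
  assumes "0 < n" "polynomial_on_Rn n p" "polynomial_on_Rn n q"
  shows "definable n (\<lambda>x. p x = q x)"
  using semialgebraic_mem[OF _ semialgebraic.eq[OF polynomial_diff[OF assms(2,3)]]] assms(1)
  by (simp add: definable_def)

lemma definable_abs_less:
  assumes "0 < n" "polynomial_on_Rn n p" "polynomial_on_Rn n q"
  shows "definable n (\<lambda>x. \<bar>p x\<bar> < q x)"
proof -
  have "definable n (\<lambda>x. p x < q x \<and> 0 - p x < q x)"
    by (intro definable_conj definable_less polynomial_intros assms)
  then show ?thesis by (simp add: abs_less_iff)
qed

text \<open>The quantified variable is stored in coordinate \<open>n\<close>, so the quantifier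
  becomes the projection axiom. A predicate of a point and a real is encoded in this way, as
  \<open>P (x(n := 0)) (x n)\<close>, throughout.\<close>

lemma definable_ex:
  assumes "definable (Suc n) (\<lambda>x. P (x(n := 0)) (x n))" "0 < n"
  shows "definable n (\<lambda>x. \<exists>u. P x u)"
proof -
  have "{x \<in> Rn n. \<exists>u. P x u} = (\<lambda>x. x(n := 0)) ` {x \<in> Rn (Suc n). P (x(n := 0)) (x n)}"
    (is "?L = ?R")
  proof
    show "?L \<subseteq> ?R"
    proof
      fix x assume "x \<in> ?L"
      then obtain u where x: "x \<in> Rn n" "P x u" by blast
      then have "x(n := 0) = x" by (auto simp: Rn_iff)
      with x have "x(n := u) \<in> {x \<in> Rn (Suc n). P (x(n := 0)) (x n)}" "x = (x(n := u))(n := 0)"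
        by (auto simp: Rn_upd_Suc)
      then show "x \<in> ?R" by blast
    qed
  qed (auto intro: Rn_Suc_upd)
  then show ?thesis
    using assms projection[of n] by (simp add: definable_def)
qed

lemma definable_all:
  assumes "definable (Suc n) (\<lambda>x. P (x(n := 0)) (x n))" "0 < n"
  shows "definable n (\<lambda>x. \<forall>u. P x u)"
  using definable_not[OF definable_ex[of n "\<lambda>x u. \<not> P x u"]] definable_not[OF assms(1)] assms(2)
  by simp

lemma definable_ex_tuple:
  assumes "definable (n + k) Q" "0 < n"
  shows "definable n (\<lambda>x. \<exists>w\<in>Rn (n + k). (\<forall>i<n. w i = x i) \<and> Q w)"
  using assms
proof (induction k arbitrary: Q)
  case 0
  have "(\<exists>w\<in>Rn (n + 0). (\<forall>i<n. w i = x i) \<and> Q w) \<longleftrightarrow> Q x" if "x \<in> Rn n" for x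
  proof -
    have "w = x" if "w \<in> Rn (n + 0)" "\<forall>i<n. w i = x i" for w
      using that \<open>x \<in> Rn n\<close> by (metis Rn_iff add_0_right ext not_less)
    then show ?thesis using that by auto
  qed
  then show ?case using 0 by (subst definable_cong) auto
next
  case (Suc k)
  have "definable (n + k) (\<lambda>x. \<exists>u. Q (x(n + k := u)))"
    using Suc.prems by (intro definable_ex) auto
  from Suc.IH[OF this \<open>0 < n\<close>] show ?case
  proof (rule iffD1[OF definable_cong, rotated], intro iffI)
    fix x
    assume "\<exists>w\<in>Rn (n + k). (\<forall>i<n. w i = x i) \<and> (\<exists>u. Q (w(n + k := u)))"
    then obtain w u where "w \<in> Rn (n + k)" "\<forall>i<n. w i = x i" "Q (w(n + k := u))" by blast
    then show "\<exists>w\<in>Rn (n + Suc k). (\<forall>i<n. w i = x i) \<and> Q w"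
      by (intro bexI[of _ "w(n + k := u)"]) (auto intro: Rn_upd_Suc)
  next
    fix x
    assume "\<exists>w\<in>Rn (n + Suc k). (\<forall>i<n. w i = x i) \<and> Q w"
    then obtain w where "w \<in> Rn (n + Suc k)" "\<forall>i<n. w i = x i" "Q w" by blast
    then show "\<exists>w\<in>Rn (n + k). (\<forall>i<n. w i = x i) \<and> (\<exists>u. Q (w(n + k := u)))"
      by (intro bexI[of _ "w(n + k := 0)"]) (auto simp: Rn_Suc_upd intro!: exI[of _ "w (n + k)"])
  qed
qed

text \<open>Coordinates are prepended one at a time by \<open>cylinder_left\<close>.\<close>

lemma definable_tail:
  assumes "A \<in> S k" "0 < k"
  shows "definable (n + k) (\<lambda>w. (\<lambda>i. w (n + i)) \<in> A)"
proof (induction n)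
  case 0
  have "{x \<in> Rn k. x \<in> A} = A" using carrier[of k A] assms by auto
  then show ?case using assms by (simp add: definable_def)
next
  case (Suc n)
  have "{x \<in> Rn (Suc (n + k)). x \<circ> Suc \<in> {x \<in> Rn (n + k). (\<lambda>i. x (n + i)) \<in> A}}
      = {x \<in> Rn (Suc n + k). (\<lambda>i. x (Suc n + i)) \<in> A}"
    by (auto simp: Rn_iff o_def)
  moreover have c: "{x \<in> Rn (n + k). (\<lambda>i. x (n + i)) \<in> A} \<in> S (n + k)"
    using Suc by (simp add: definable_def)
  have "{x \<in> Rn (Suc (n + k)). x \<circ> Suc \<in> {x \<in> Rn (n + k). (\<lambda>i. x (n + i)) \<in> A}}
      \<in> S (Suc (n + k))"
    using cylinder_left[OF _ c] assms(2) by (simp del: mem_Collect_eq)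
  ultimately show ?case by (simp only: definable_def add_Suc) simp
qed

text \<open>The preimage of \<open>A\<close> under a polynomial map is a projection of the part of
  its graph that lies over \<open>A\<close>.\<close>

lemma definable_subst:
  assumes A: "A \<in> S k" and "0 < k" "0 < n"
    and G: "\<And>x. x \<in> Rn n \<Longrightarrow> G x \<in> Rn k" "\<And>i. i < k \<Longrightarrow> polynomial_on_Rn n (\<lambda>x. G x i)"
  shows "definable n (\<lambda>x. G x \<in> A)"
proof -
  let ?t = "\<lambda>w i. if i < n then w i else 0 :: real"
  \<comment> \<open>\<open>w\<close> holds \<open>x\<close> followed by a candidate for
    \<open>G x\<close>; \<open>?t\<close> recovers \<open>x\<close> by filling up with
    zeros.\<close>
  have "definable (n + k) (\<lambda>w. (\<lambda>i. w (n + i)) \<in> A \<and> (\<forall>i\<in>{..<k}. w (n + i) = G (?t w) i))"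
    using assms by (intro definable_conj definable_tail definable_finite_ball definable_eq
        polynomial_lift[of n "\<lambda>x. G x i" for i]) (auto intro: polynomial_on_Rn.coord)
  from definable_ex_tuple[OF this \<open>0 < n\<close>] show ?thesis
  proof (rule iffD1[OF definable_cong, rotated], intro iffI)
    fix x
    assume x: "x \<in> Rn n" and "\<exists>w\<in>Rn (n + k). (\<forall>i<n. w i = x i) \<and>
      (\<lambda>i. w (n + i)) \<in> A \<and> (\<forall>i\<in>{..<k}. w (n + i) = G (?t w) i)"
    then obtain w where w: "w \<in> Rn (n + k)" "\<forall>i<n. w i = x i" "(\<lambda>i. w (n + i)) \<in> A"
      "\<forall>i<k. w (n + i) = G (?t w) i" by auto
    have "?t w = x" using x w by (auto simp: Rn_iff)
    have "w (n + i) = G x i" for i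
    proof (cases "i < k")
      case True
      then show ?thesis using w(4) \<open>?t w = x\<close> by simp
    next
      case False
      then show ?thesis using w(1) G(1)[OF x] by (simp add: Rn_iff)
    qed
    then have "(\<lambda>i. w (n + i)) = G x" by blast
    then show "G x \<in> A" using w by simp
  next
    fix x assume x: "x \<in> Rn n" and "G x \<in> A"
    let ?w = "\<lambda>i. if i < n then x i else G x (i - n)"
    have "?t ?w = x" using x by (auto simp: Rn_iff)
    then show "\<exists>w\<in>Rn (n + k). (\<forall>i<n. w i = x i) \<and>
      (\<lambda>i. w (n + i)) \<in> A \<and> (\<forall>i\<in>{..<k}. w (n + i) = G (?t w) i)"
      using \<open>G x \<in> A\<close> G(1)[OF x] by (intro bexI[of _ ?w]) (auto simp: Rn_iff)
  qed
qed

lemma definable_comp: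
  assumes "definable k P" "0 < n"
    and "\<And>x. x \<in> Rn n \<Longrightarrow> G x \<in> Rn k" "\<And>i. i < k \<Longrightarrow> polynomial_on_Rn n (\<lambda>x. G x i)"
  shows "definable n (\<lambda>x. P (G x))"
  using definable_subst[of "{x \<in> Rn k. P x}" k n G] assms
  by (subst definable_cong[where Q = "\<lambda>x. G x \<in> {x \<in> Rn k. P x}"]) (auto simp: definable_def)

text \<open>The form of substitution that handles atoms below quantifiers, where the last argument
  is itself a polynomial in the variables.\<close>

lemma definable_comp2:
  assumes "definable (Suc k) (\<lambda>z. P (z(k := 0)) (z k))" "0 < n"
    and G: "\<And>x. x \<in> Rn n \<Longrightarrow> G x \<in> Rn k" "\<And>i. i < k \<Longrightarrow> polynomial_on_Rn n (\<lambda>x. G x i)"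
    and "polynomial_on_Rn n h"
  shows "definable n (\<lambda>x. P (G x) (h x))"
proof -
  have "definable n (\<lambda>x. P (((G x)(k := h x))(k := 0)) (((G x)(k := h x)) k))"
    using assms by (intro definable_comp[OF assms(1), where G = "\<lambda>x. (G x)(k := h x)"])
      (auto intro: Rn_upd_Suc intro!: polynomial_if)
  moreover have "((G x)(k := h x))(k := 0) = G x" if "x \<in> Rn n" for x
    using G(1)[OF that] by (auto simp: Rn_iff)
  ultimately show ?thesis by (simp cong: definable_cong)
qed

lemma definable_ex_Rn:
  assumes "definable (n + k) (\<lambda>w. P (\<lambda>i. if i < n then w i else 0) (\<lambda>i. w (n + i)))" "0 < n"
  shows "definable n (\<lambda>x. \<exists>z\<in>Rn k. P x z)"
  using definable_ex_tuple[OF assms]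
proof (rule iffD1[OF definable_cong, rotated], intro iffI)
  fix x
  assume x: "x \<in> Rn n" and "\<exists>w\<in>Rn (n + k). (\<forall>i<n. w i = x i) \<and>
      P (\<lambda>i. if i < n then w i else 0) (\<lambda>i. w (n + i))"
  then obtain w where w: "w \<in> Rn (n + k)" "\<forall>i<n. w i = x i"
    "P (\<lambda>i. if i < n then w i else 0) (\<lambda>i. w (n + i))" by auto
  have "(\<lambda>i. if i < n then w i else 0) = x" using x w by (auto simp: Rn_iff)
  with w show "\<exists>z\<in>Rn k. P x z" by (auto simp: Rn_iff)
next
  fix x assume x: "x \<in> Rn n" and "\<exists>z\<in>Rn k. P x z"
  then obtain z where z: "z \<in> Rn k" "P x z" by blast
  let ?w = "\<lambda>i. if i < n then x i else z (i - n)"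
  have "(\<lambda>i. if i < n then ?w i else 0) = x" using x by (auto simp: Rn_iff)
  then show "\<exists>w\<in>Rn (n + k). (\<forall>i<n. w i = x i) \<and>
      P (\<lambda>i. if i < n then w i else 0) (\<lambda>i. w (n + i))"
    using z by (intro bexI[of _ ?w]) (auto simp: Rn_iff)
qed

text \<open>The graph again, now with the value as the first block and the argument quantified
  away.\<close>

lemma definable_image:
  assumes A: "A \<in> S n" and "0 < n" "0 < k"
    and G: "\<And>x. x \<in> Rn n \<Longrightarrow> G x \<in> Rn k" "\<And>i. i < k \<Longrightarrow> polynomial_on_Rn n (\<lambda>x. G x i)"
  shows "G ` A \<in> S k"
proof -
  have AR: "A \<subseteq> Rn n" using carrier A \<open>0 < n\<close> by simp
  have *: "polynomial_on_Rn (k + n) (\<lambda>w. G (\<lambda>i. w (k + i)) i)" if "i < k" for i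
    using polynomial_tail[OF G(2)[OF that]] .
  have "definable (k + n) (\<lambda>w. (\<lambda>i. w (k + i)) \<in> A \<and>
      (\<forall>i\<in>{..<k}. (if i < k then w i else 0) = G (\<lambda>i. w (k + i)) i))"
    using assms * by (intro definable_conj definable_tail definable_finite_ball definable_eq)
      (auto intro: polynomial_on_Rn.coord)
  then have "definable k (\<lambda>x. \<exists>z\<in>Rn n. z \<in> A \<and> (\<forall>i\<in>{..<k}. x i = G z i))"
    using definable_ex_Rn[where P = "\<lambda>x z. z \<in> A \<and> (\<forall>i\<in>{..<k}. x i = G z i)" and n = k and k = n]
      \<open>0 < k\<close> by simp
  moreover have "x \<in> Rn k \<and> (\<exists>z\<in>Rn n. z \<in> A \<and> (\<forall>i\<in>{..<k}. x i = G z i)) \<longleftrightarrow> x \<in> G ` A" for x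
  proof
    assume L: "x \<in> Rn k \<and> (\<exists>z\<in>Rn n. z \<in> A \<and> (\<forall>i\<in>{..<k}. x i = G z i))"
    then obtain z where z: "z \<in> Rn n" "z \<in> A" "\<forall>i<k. x i = G z i" by auto
    have "x = G z" using L z G(1)[OF z(1)] by (metis Rn_iff ext not_less)
    with z show "x \<in> G ` A" by blast
  next
    assume "x \<in> G ` A"
    then show "x \<in> Rn k \<and> (\<exists>z\<in>Rn n. z \<in> A \<and> (\<forall>i\<in>{..<k}. x i = G z i))"
      using AR G(1) by blast
  qed
  ultimately show ?thesis by (simp add: definable_def)
qed

section \<open>Definable subsets of a line\<close>

lemma finite_frontier_open_interval_or_point:
  assumes "open_interval_or_point J"
  shows "finite (frontier J)"
  using assms unfolding open_interval_or_point_def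
proof (elim disjE exE)
  fix a b :: ereal assume J: "J = {x. a < ereal x \<and> ereal x < b}"
  have "open J" unfolding J by (intro open_Collect_conj open_Collect_less continuous_intros)
  have "closed {x. a \<le> ereal x \<and> ereal x \<le> b}"
    by (intro closed_Collect_conj closed_Collect_le continuous_intros)
  then have "closure J \<subseteq> {x. a \<le> ereal x \<and> ereal x \<le> b}"
    by (intro closure_minimal) (auto simp: J)
  \<comment> \<open>An infinite endpoint is sent to 0, which at most adds a harmless point to the
    finite bound.\<close>
  then have "frontier J \<subseteq> {real_of_ereal a, real_of_ereal b}"
    unfolding frontier_def interior_open[OF \<open>open J\<close>] by (auto simp: J less_le)
  then show ?thesis by (rule finite_subset) simp
next
  fix r assume "J = {r}"
  then show ?thesis by (auto intro: finite_subset[OF frontier_subset_closed])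
qed

text \<open>Here the axiom \<open>tame\<close> enters: the frontier of a finite union lies in the
  union of the frontiers, and an interval or point has finite frontier.\<close>

lemma finite_frontier_section:
  assumes "definable 1 (\<lambda>x. x 0 \<in> E)"
  shows "finite (frontier E)"
proof -
  have "{x \<in> Rn 1. x 0 \<in> E} \<in> S 1" using assms by (simp add: definable_def)
  from tame[OF this] obtain F where F: "finite F" "\<forall>J\<in>F. open_interval_or_point J"
      "{x \<in> Rn 1. x 0 \<in> E} = {x \<in> Rn 1. x 0 \<in> \<Union>F}"
    by (elim exE conjE) (rule that; assumption)
  have "u \<in> E \<longleftrightarrow> u \<in> \<Union>F" for u
  proof -
    have "(\<lambda>i. if i = 0 then u else 0) \<in> Rn 1" by (simp add: Rn_iff)
    then show ?thesis using F(3) by (smt (verit) mem_Collect_eq)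
  qed
  then have "E = \<Union>F" by blast
  then have "frontier E \<subseteq> (\<Union>J\<in>F. frontier J)"
    using frontier_Union_subset[OF F(1)] by simp
  moreover have "finite (\<Union>J\<in>F. frontier J)"
    using F(1,2) finite_frontier_open_interval_or_point by blast
  ultimately show ?thesis by (rule finite_subset)
qed

lemma finite_frontier_line:
  assumes "definable n P" "y \<in> Rn n" "i < n"
  shows "finite (frontier {u. P (y(i := u))})"
proof (rule finite_frontier_section)
  have "definable 1 (\<lambda>x. P (y(i := x 0)))"
    using assms by (intro definable_comp[where G = "\<lambda>x. y(i := x 0)" and P = P])
      (auto intro: Rn_upd polynomial_intros)
  then show "definable 1 (\<lambda>x. x 0 \<in> {u. P (y(i := u))})" by simp
qed

end

section \<open>Uniform finiteness\<close>

text \<open>A countable set of reals has empty interior and so lies in its own frontier.\<close>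

lemma finite_of_countable_finite_frontier:
  fixes E :: "real set"
  assumes "countable E" "finite (frontier E)"
  shows "finite E"
proof -
  have "interior E = {}"
  proof (rule ccontr)
    assume "interior E \<noteq> {}"
    then obtain x e where "e > 0" "ball x e \<subseteq> E" by (auto simp: mem_interior)
    then have "{x - e<..<x + e} \<subseteq> E" by (auto simp: ball_eq_greaterThanLessThan)
    then show False
      using \<open>countable E\<close> \<open>e > 0\<close> countable_subset uncountable_open_interval[of "x - e" "x + e"] by force
  qed
  then have "E \<subseteq> frontier E" using closure_subset by (auto simp: frontier_def)
  then show ?thesis using assms(2) finite_subset by blast
qed

lemma mem_frontierI: "x \<in> A \<Longrightarrow> x \<notin> interior A \<Longrightarrow> x \<in> frontier A"
  using closure_subset by (auto simp: frontier_def)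

lemma finite_separated:
  fixes A :: "real set"
  assumes "finite A"
  obtains d where "d > 0" "\<And>a b. a \<in> A \<Longrightarrow> b \<in> A \<Longrightarrow> a \<noteq> b \<Longrightarrow> d \<le> \<bar>a - b\<bar>"
proof -
  \<comment> \<open>The extra 1 keeps the minimum meaningful when \<open>A\<close> has fewer than
    two points.\<close>
  let ?D = "insert 1 ((\<lambda>(a, b). \<bar>a - b\<bar>) ` {(a, b) \<in> A \<times> A. a \<noteq> b})"
  have "finite {(a, b) \<in> A \<times> A. a \<noteq> b}"
    by (rule finite_subset[of _ "A \<times> A"]) (use assms in auto)
  then have fin: "finite ?D" by simp
  show thesis
  proof
    show "Min ?D > 0" using fin by (subst Min_gr_iff) auto
    fix a b assume "a \<in> A" "b \<in> A" "a \<noteq> b"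
    then show "Min ?D \<le> \<bar>a - b\<bar>" using fin by (intro Min_le) auto
  qed
qed

lemma card_eq_of_matching:
  assumes "\<And>x. x \<in> A \<Longrightarrow> \<exists>!y. y \<in> B \<and> R x y" "\<And>y. y \<in> B \<Longrightarrow> \<exists>!x. x \<in> A \<and> R x y"
  shows "card A = card B"
proof -
  obtain g where g: "\<And>x. x \<in> A \<Longrightarrow> g x \<in> B \<and> R x (g x)"
    using assms(1) by metis
  have "bij_betw g A B"
  proof (rule bij_betwI')
    show "g x = g y \<longleftrightarrow> x = y" if "x \<in> A" "y \<in> A" for x y
      using assms(2) g that by metis
    show "g x \<in> B" if "x \<in> A" for x using g that by blast
    show "\<exists>x\<in>A. y = g x" if "y \<in> B" for y
      using assms g that by metis
  qed
  then show ?thesis by (rule bij_betw_same_card)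
qed

section \<open>Cardinality of fibers along a line of parameters\<close>

context semialgebraic_o_minimal
begin

lemmas definable_intros = definable_conj definable_disj definable_imp definable_ex definable_all
  definable_less definable_abs_less definable_eq definable_not definable_finite_bex
  polynomial_intros Rn_upd_Suc Rn_Suc_upd zero_less_Suc

text \<open>Local constancy of the fiber cardinality in \<open>u\<close>, expressed by a formula: proximity is a perfect
  matching between the fibers over \<open>(s, u)\<close> and \<open>(s, v)\<close> for all \<open>v\<close> near \<open>u\<close>.\<close>

definition good :: "nat \<Rightarrow> ((nat \<Rightarrow> real) \<Rightarrow> real \<Rightarrow> bool) \<Rightarrow> (nat \<Rightarrow> real) \<Rightarrow> real \<Rightarrow> bool"
  where "good p X s u \<longleftrightarrow> (\<exists>e d. 0 < d \<and> (\<forall>v. \<bar>v - u\<bar> < d \<longrightarrow>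
    (\<forall>x. X (s(p := v)) x \<longrightarrow> (\<exists>!y. X (s(p := u)) y \<and> \<bar>x - y\<bar> < e)) \<and>
    (\<forall>y. X (s(p := u)) y \<longrightarrow> (\<exists>!x. X (s(p := v)) x \<and> \<bar>x - y\<bar> < e))))"

lemma definable_good:
  assumes X: "definable (Suc (Suc p)) (\<lambda>z. X (z(Suc p := 0)) (z (Suc p)))"
  shows "definable (Suc p) (\<lambda>z. good p X (z(p := 0)) (z p))"
  unfolding good_def Ex1_def
  by (intro definable_intros definable_comp2[OF X])
    simp_all

text \<open>The bad set is definable, so its frontier is finite. It is also countable, being covered
  by the countably many finite frontiers collected in \<open>E\<close>; hence it is finite.\<close>

lemma bad_finite:
  assumes X: "definable (Suc (Suc p)) (\<lambda>z. X (z(Suc p := 0)) (z (Suc p)))"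
    and fin: "\<And>t. t \<in> Rn (Suc p) \<Longrightarrow> finite {u. X t u}"
    and s: "s \<in> Rn p"
  shows "finite {u. \<not> good p X s u}"
proof (rule finite_of_countable_finite_frontier)
  have s': "s \<in> Rn (Suc p)" "s(p := v) \<in> Rn (Suc p)" for v using s by (auto simp: Rn_iff)
  have sp: "s(p := 0) = s" using s by (auto simp: Rn_iff)
  \<comment> \<open>\<open>C\<close> confines the fiber over \<open>v\<close> to given small
    intervals and \<open>U\<close> puts exactly one point into one of them; together they force a
    matching with the fiber over \<open>u\<close>. Rational centers and radii leave only countably
    many such conditions.\<close>
  define C where "C F r v \<longleftrightarrow> (\<forall>x. X (s(p := v)) x \<longrightarrow> (\<exists>f\<in>F. \<bar>x - f\<bar> < r))" for F :: "real set" and r v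
  define U where "U f r v \<longleftrightarrow> (\<exists>!x. X (s(p := v)) x \<and> \<bar>x - f\<bar> < r)" for f r v
  define E where "E = (\<Union>F\<in>{F. F \<subseteq> \<rat> \<and> finite F}. \<Union>r\<in>\<rat>. frontier {v. C F r v}) \<union>
    (\<Union>f\<in>\<rat>. \<Union>r\<in>\<rat>. frontier {v. U f r v})"
  have C_fin: "finite (frontier {v. C F r v})" if "finite F" for F r
  proof -
    have "definable (Suc p) (\<lambda>z. \<forall>x. X z x \<longrightarrow> (\<exists>f\<in>F. \<bar>x - f\<bar> < r))"
      by (intro definable_intros definable_comp2[OF X] that)
        simp_all
    from finite_frontier_line[OF this s'(1), of p] show ?thesis by (simp add: C_def)
  qed
  have U_fin: "finite (frontier {v. U f r v})" for f r
  proof -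
    have "definable (Suc p) (\<lambda>z. \<exists>!x. X z x \<and> \<bar>x - f\<bar> < r)"
      unfolding Ex1_def
      by (intro definable_intros definable_comp2[OF X])
        simp_all
    from finite_frontier_line[OF this s'(1), of p] show ?thesis by (simp add: U_def)
  qed
  have "countable E"
  proof -
    have "countable {F :: real set. F \<subseteq> \<rat> \<and> finite F}"
      using countable_Collect_finite_subset[OF countable_rat] by (simp add: conj_commute)
    then show ?thesis
      unfolding E_def using C_fin U_fin
      by (intro countable_Un countable_UN countable_rat) (auto intro: countable_finite)
  qed
  moreover have "{u. \<not> good p X s u} \<subseteq> E"
  proof (clarify, rule ccontr)
    fix u assume bad: "\<not> good p X s u" and u: "u \<notin> E"
    let ?A = "{x. X (s(p := u)) x}"
    have A: "finite ?A" using fin s' by blast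
    then obtain d where d: "d > 0" "\<And>a b. a \<in> ?A \<Longrightarrow> b \<in> ?A \<Longrightarrow> a \<noteq> b \<Longrightarrow> d \<le> \<bar>a - b\<bar>"
      using finite_separated by blast
    obtain r where r: "r \<in> \<rat>" "0 < r" "r < d / 4"
      using Rats_dense_in_real[of 0 "d / 4"] d(1) by auto
    have "\<exists>f\<in>\<rat>. \<bar>a - f\<bar> < r" for a
    proof -
      obtain f where "f \<in> \<rat>" "a - r < f" "f < a" using Rats_dense_in_real[of "a - r" a] r(2) by auto
      then show ?thesis by (intro bexI[of _ f]) auto
    qed
    then obtain f where f: "\<And>a. f a \<in> \<rat>" "\<And>a. \<bar>a - f a\<bar> < r" by metis
    let ?O = "interior {v. C (f ` ?A) r v} \<inter> (\<Inter>a\<in>?A. interior {v. U (f a) r v})"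
    have "u \<in> interior {v. C (f ` ?A) r v}"
    \<comment> \<open>The condition holds at \<open>u\<close>, and \<open>u\<close> is off its
      frontier because it is off \<open>E\<close>, so it persists near \<open>u\<close>. The same
      argument applies to each \<open>U (f a) r\<close>; finitely many conditions give the open set
      \<open>?O\<close>.\<close>
    proof (rule ccontr)
      assume "u \<notin> interior {v. C (f ` ?A) r v}"
      moreover have "C (f ` ?A) r u" using f by (auto simp: C_def)
      ultimately have "u \<in> frontier {v. C (f ` ?A) r v}"
        by (intro mem_frontierI) auto
      moreover have "f ` ?A \<in> {F. F \<subseteq> \<rat> \<and> finite F}" using A f(1) by auto
      ultimately have "u \<in> E" using r(1) unfolding E_def by blast
      with u show False by blast
    qed
    moreover have "u \<in> interior {v. U (f a) r v}" if a: "a \<in> ?A" for a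
    proof (rule ccontr)
      assume "u \<notin> interior {v. U (f a) r v}"
      moreover have "U (f a) r u"
        unfolding U_def
      proof (rule ex1I[of _ a])
        show "X (s(p := u)) a \<and> \<bar>a - f a\<bar> < r" using a f by simp
        fix x assume x: "X (s(p := u)) x \<and> \<bar>x - f a\<bar> < r"
        show "x = a"
        proof (rule ccontr)
          assume "x \<noteq> a"
          then have "d \<le> \<bar>x - a\<bar>" using d(2) a x by blast
          then show False using x f(2)[of a] r by linarith
        qed
      qed
      ultimately have "u \<in> frontier {v. U (f a) r v}"
        by (intro mem_frontierI) auto
      then have "u \<in> E" using f(1) r(1) unfolding E_def by blast
      with u show False by blast
    qed
    ultimately have "u \<in> ?O" by blast
    moreover have "open ?O" using A by (intro open_Int open_INT) auto
    ultimately obtain e where e: "e > 0" "\<And>v. \<bar>v - u\<bar> < e \<Longrightarrow> v \<in> ?O"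
      unfolding open_dist dist_real_def by blast
    \<comment> \<open>Passing from a rational center \<open>f a\<close> to the point
      \<open>a\<close> costs another \<open>r\<close>, whence the matching radius
      \<open>2 * r\<close>. A second partner would put two points of the fiber over \<open>u\<close>
      at distance below \<open>4 * r < d\<close>.\<close>
    have "(\<forall>x. X (s(p := v)) x \<longrightarrow> (\<exists>!y. X (s(p := u)) y \<and> \<bar>x - y\<bar> < 2 * r)) \<and>
      (\<forall>y. X (s(p := u)) y \<longrightarrow> (\<exists>!x. X (s(p := v)) x \<and> \<bar>x - y\<bar> < 2 * r))"
      if "\<bar>v - u\<bar> < e" for v
    proof -
      from that
      have "v \<in> ?O" by (rule e(2))
      then have v: "C (f ` ?A) r v" "\<And>a. a \<in> ?A \<Longrightarrow> U (f a) r v"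
        using interior_subset by blast+
      have near: "\<exists>a\<in>?A. \<bar>x - f a\<bar> < r" if "X (s(p := v)) x" for x
        using v(1) that by (auto simp: C_def)
      have close: "y = a" if "\<bar>x - f a\<bar> < r" "\<bar>x - y\<bar> < 2 * r" "a \<in> ?A" "y \<in> ?A" for x y a
      proof (rule ccontr)
        assume "y \<noteq> a"
        then have "d \<le> \<bar>y - a\<bar>" using d(2) that by blast
        then show False using that f(2)[of a] r by linarith
      qed
      have "\<exists>!y. X (s(p := u)) y \<and> \<bar>x - y\<bar> < 2 * r" if x: "X (s(p := v)) x" for x
      proof -
        obtain a where a: "a \<in> ?A" "\<bar>x - f a\<bar> < r" using near[OF x] by blast
        then have "\<bar>x - a\<bar> < 2 * r" using f(2)[of a] by linarith
        with a close[OF a(2) _ a(1)] show ?thesis by blast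
      qed
      moreover have "\<exists>!x. X (s(p := v)) x \<and> \<bar>x - y\<bar> < 2 * r" if y: "X (s(p := u)) y" for y
      proof -
        have "\<exists>!x. X (s(p := v)) x \<and> \<bar>x - f y\<bar> < r" using v(2) y by (auto simp: U_def)
        then obtain x where x: "X (s(p := v)) x" "\<bar>x - f y\<bar> < r"
            and un: "\<And>x'. X (s(p := v)) x' \<Longrightarrow> \<bar>x' - f y\<bar> < r \<Longrightarrow> x' = x" by blast
        show ?thesis
        proof (rule ex1I[of _ x])
          show "X (s(p := v)) x \<and> \<bar>x - y\<bar> < 2 * r" using x f(2)[of y] by linarith
          fix x' assume x': "X (s(p := v)) x' \<and> \<bar>x' - y\<bar> < 2 * r"
          then obtain a where a: "a \<in> ?A" "\<bar>x' - f a\<bar> < r" using near by blast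
          then have "y = a" using close[OF a(2) _ a(1)] x' y by blast
          then show "x' = x" using un x' a by blast
        qed
      qed
      ultimately show ?thesis by blast
    qed
    then have "good p X s u" unfolding good_def using e(1) by blast
    with bad show False by blast
  qed
  ultimately show "countable {u. \<not> good p X s u}" by (rule countable_subset[rotated])
  have "definable (Suc p) (\<lambda>z. \<not> good p X (z(p := 0)) (z p))"
    by (intro definable_not definable_good X)
  from finite_frontier_line[OF this s'(1), of p] sp
  show "finite (frontier {u. \<not> good p X s u})" by simp
qed

text \<open>The matchings make the cardinality locally constant on a connected set.\<close>

lemma good_interval_card:
  assumes "connected J" "\<And>u. u \<in> J \<Longrightarrow> good p X s u" "u \<in> J" "w \<in> J"
  shows "card {x. X (s(p := u)) x} = card {x. X (s(p := w)) x}"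
proof (rule connected_local_const[OF assms(1,3,4)], intro ballI)
  fix a assume "a \<in> J"
  then have "good p X s a" by (rule assms(2))
  then obtain e d where d: "0 < d" "\<And>v. \<bar>v - a\<bar> < d \<Longrightarrow>
    (\<forall>x. X (s(p := v)) x \<longrightarrow> (\<exists>!y. X (s(p := a)) y \<and> \<bar>x - y\<bar> < e)) \<and>
    (\<forall>y. X (s(p := a)) y \<longrightarrow> (\<exists>!x. X (s(p := v)) x \<and> \<bar>x - y\<bar> < e))"
    unfolding good_def by blast
  have "card {x. X (s(p := a)) x} = card {x. X (s(p := v)) x}" if "dist v a < d" for v
    using d(2)[of v] that
    by (intro card_eq_of_matching[symmetric, where R = "\<lambda>x y. \<bar>x - y\<bar> < e"]) (auto simp: dist_real_def)
  then show "\<forall>\<^sub>F v in at a within J. card {x. X (s(p := a)) x} = card {x. X (s(p := v)) x}"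
    unfolding eventually_at using d(1) by blast
qed

text \<open>The last parameter is eliminated by merging the fibers over finitely many sample values
  of it into one finite fiber, to which the induction hypothesis applies.\<close>

theorem uniform_finiteness:
  assumes "definable (Suc p) (\<lambda>z. X (z(p := 0)) (z p))"
    and "\<And>t. t \<in> Rn p \<Longrightarrow> finite {u. X t u}"
  shows "\<exists>N. \<forall>t\<in>Rn p. card {u. X t u} \<le> N"
  using assms
proof (induction p arbitrary: X)
  case 0
  have "Rn 0 = {\<lambda>_. 0}" by (auto simp: Rn_iff)
  then show ?case by auto
next
  case (Suc p)
  note X = Suc.prems(1)
  \<comment> \<open>\<open>W s\<close> contains the bad points and meets every component of their complement.\<close>
  define W where "W s w \<longleftrightarrow> (\<exists>a b. \<not> good p X s a \<and> \<not> good p X s b \<and> 2 * w = a + b) \<or>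
    \<not> good p X s (w - 1) \<or> \<not> good p X s (w + 1) \<or> w = 0" for s w
  have W_fin: "finite {w. W s w}" if "s \<in> Rn p" for s
  proof -
    let ?B = "{u. \<not> good p X s u}"
    have "finite ?B" using bad_finite[OF Suc.prems that] .
    then have "finite ((\<lambda>(a, b). (a + b) / 2) ` (?B \<times> ?B) \<union> (\<lambda>a. a + 1) ` ?B \<union> (\<lambda>a. a - 1) ` ?B \<union> {0})"
      by blast
    moreover have "{w. W s w} \<subseteq> \<dots>"
      by (force simp: W_def image_iff)
    ultimately show ?thesis by (rule finite_subset[rotated])
  qed
  have W_meets: "\<exists>w. W s w \<and> card {x. X (s(p := u)) x} = card {x. X (s(p := w)) x}"
    if s: "s \<in> Rn p" for s u
  proof (cases "good p X s u")
    case False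
    then have "W s u" unfolding W_def by (metis mult_2)
    then show ?thesis by blast
  next
    case True
    let ?L = "{a. \<not> good p X s a \<and> a < u}" and ?R = "{b. \<not> good p X s b \<and> u < b}"
    have fin: "finite ?L" "finite ?R" by (auto intro: finite_subset[OF _ bad_finite[OF Suc.prems s]])
    \<comment> \<open>The component of good points around \<open>u\<close> ends at the nearest bad
      point on each side, if there is one.\<close>
    have L: "(\<forall>v\<le>u. good p X s v) \<or>
        (\<exists>l<u. \<not> good p X s l \<and> (\<forall>v. l < v \<and> v \<le> u \<longrightarrow> good p X s v))" (is "?Lall \<or> ?Lex")
    proof (cases "?L = {}")
      case True
      then have ?Lall using \<open>good p X s u\<close> by (auto simp: le_less)
      then show ?thesis ..
    next
      case False
      then have M: "Max ?L \<in> ?L" using Max_in[OF fin(1)] by blast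
      have "good p X s v" if "Max ?L < v" "v \<le> u" for v
        using Max_ge[OF fin(1), of v] that \<open>good p X s u\<close> by (cases "v = u") (auto simp: not_le[symmetric])
      with M have ?Lex by blast
      then show ?thesis ..
    qed
    have R: "(\<forall>v\<ge>u. good p X s v) \<or>
        (\<exists>r>u. \<not> good p X s r \<and> (\<forall>v. u \<le> v \<and> v < r \<longrightarrow> good p X s v))" (is "?Rall \<or> ?Rex")
    proof (cases "?R = {}")
      case True
      then have ?Rall using \<open>good p X s u\<close> by (auto simp: le_less)
      then show ?thesis ..
    next
      case False
      then have M: "Min ?R \<in> ?R" using Min_in[OF fin(2)] by blast
      have "good p X s v" if "v < Min ?R" "u \<le> v" for v
        using Min_le[OF fin(2), of v] that \<open>good p X s u\<close> by (cases "v = u") (auto simp: not_le[symmetric])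
      with M have ?Rex by blast
      then show ?thesis ..
    qed
    have ex: ?thesis if "connected J" "\<And>v. v \<in> J \<Longrightarrow> good p X s v" "u \<in> J" "w \<in> J" "W s w" for J w
      using good_interval_card[OF that(1-4)] that(5) by blast
    \<comment> \<open>The sample in the component of \<open>u\<close> is 0 on the whole line,
      \<open>r - 1\<close> or \<open>l + 1\<close> on a half-line, and the midpoint on a bounded
      interval.\<close>
    show ?thesis
      using L R
    proof (elim disjE exE conjE)
      assume "\<forall>v\<le>u. good p X s v" "\<forall>v\<ge>u. good p X s v"
      then have "good p X s v" for v by (meson linear)
      then show ?thesis by (rule ex[of UNIV 0, OF connected_UNIV]) (simp_all add: W_def)
    next
      fix r assume e: "\<forall>v\<le>u. good p X s v" "u < r" "\<not> good p X s r"
        "\<forall>v. u \<le> v \<and> v < r \<longrightarrow> good p X s v"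
      then have "good p X s v" if "v < r" for v using that by (meson linear)
      then show ?thesis using e(2,3)
        by (intro ex[of "{..<r}" "r - 1"] connected_Iio) (simp_all add: W_def)
    next
      fix l assume e: "\<forall>v\<ge>u. good p X s v" "l < u" "\<not> good p X s l"
        "\<forall>v. l < v \<and> v \<le> u \<longrightarrow> good p X s v"
      then have "good p X s v" if "l < v" for v using that by (meson linear)
      then show ?thesis using e(2,3)
        by (intro ex[of "{l<..}" "l + 1"] connected_Ioi) (simp_all add: W_def)
    next
      fix l r assume e: "l < u" "\<not> good p X s l" "\<forall>v. l < v \<and> v \<le> u \<longrightarrow> good p X s v"
        "u < r" "\<not> good p X s r" "\<forall>v. u \<le> v \<and> v < r \<longrightarrow> good p X s v"
      then have "good p X s v" if "l < v" "v < r" for v using that by (meson linear)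
      moreover have "W s ((l + r) / 2)"
        using e unfolding W_def by (intro disjI1 exI[of _ l] exI[of _ r]) simp
      ultimately show ?thesis using e(1,4)
        by (intro ex[of "{l<..<r}" "(l + r) / 2"] connected_Ioo) simp_all
    qed
  qed
  have fin_union: "finite {x. \<exists>w. W s w \<and> X (s(p := w)) x}" if s: "s \<in> Rn p" for s
  proof -
    have "{x. \<exists>w. W s w \<and> X (s(p := w)) x} = (\<Union>w\<in>{w. W s w}. {x. X (s(p := w)) x})" by auto
    also have "finite \<dots>"
      by (intro finite_UN_I W_fin[OF s] Suc.prems(2) Rn_upd_Suc[OF s])
    finally show ?thesis .
  qed
  \<comment> \<open>The union of the sampled fibers is a definable family with one parameter fewer,
    and it contains a set of the same cardinality as any given fiber of \<open>X\<close>.\<close>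
  have "\<exists>N. \<forall>s\<in>Rn p. card {x. \<exists>w. W s w \<and> X (s(p := w)) x} \<le> N"
  proof (rule Suc.IH)
    show "definable (Suc p) (\<lambda>z. \<exists>w. W (z(p := 0)) w \<and> X ((z(p := 0))(p := w)) (z p))"
      unfolding W_def
      by (intro definable_intros definable_comp2[OF X] definable_comp2[OF definable_good[OF X]])
        simp_all
    fix s assume s: "s \<in> Rn p"
    show "finite {x. \<exists>w. W s w \<and> X (s(p := w)) x}" by (rule fin_union[OF s])
  qed
  then obtain N where N: "\<And>s. s \<in> Rn p \<Longrightarrow> card {x. \<exists>w. W s w \<and> X (s(p := w)) x} \<le> N" by blast
  have "card {u. X t u} \<le> N" if t: "t \<in> Rn (Suc p)" for t
  proof -
    let ?s = "t(p := 0)"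
    have s: "?s \<in> Rn p" using t by (rule Rn_Suc_upd)
    obtain w where w: "W ?s w" "card {x. X (?s(p := t p)) x} = card {x. X (?s(p := w)) x}"
      using W_meets[OF s] by blast
    have "finite {x. \<exists>w. W ?s w \<and> X (?s(p := w)) x}" by (rule fin_union[OF s])
    then have "card {x. X (?s(p := w)) x} \<le> card {x. \<exists>w. W ?s w \<and> X (?s(p := w)) x}"
      using w(1) by (intro card_mono) auto
    then show ?thesis using N[OF s] w(2) by simp
  qed
  then show ?case by blast
qed

text \<open>Lying in the frontier is a first-order condition, expressed by points of the set and of
  its complement at arbitrarily small distance. Each frontier is finite by tameness, so uniform
  finiteness bounds them all.\<close>

corollary uniform_frontier:
  assumes X: "definable (Suc p) (\<lambda>z. X (z(p := 0)) (z p))"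
  shows "\<exists>N. \<forall>t\<in>Rn p. finite (frontier {u. X t u}) \<and> card (frontier {u. X t u}) \<le> N"
proof -
  define Y where "Y t u \<longleftrightarrow> (\<forall>e. 0 < e \<longrightarrow> (\<exists>x. X t x \<and> \<bar>x - u\<bar> < e) \<and> (\<exists>x. \<not> X t x \<and> \<bar>x - u\<bar> < e))"
    for t u
  have Y: "{u. Y t u} = frontier {u. X t u}" for t
    by (auto simp: Y_def frontier_straddle dist_real_def abs_minus_commute)
  have fin: "finite {u. Y t u}" if "t \<in> Rn p" for t
  proof -
    have "t \<in> Rn (Suc p)" "t(p := 0) = t" using that by (auto simp: Rn_iff)
    with finite_frontier_line[OF X, of t p] show ?thesis by (simp add: Y)
  qed
  have "definable (Suc p) (\<lambda>z. Y (z(p := 0)) (z p))"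
    unfolding Y_def
    by (intro definable_intros definable_comp2[OF X]) simp_all
  from uniform_finiteness[OF this fin] show ?thesis using fin by (simp add: Y)
qed

end

section \<open>Volumes of definable sets\<close>

text \<open>Orthogonal projection onto the coordinate subspace of the axes in \<open>I\<close>;
  preimages under it are cylinders over that subspace.\<close>

definition zero_ext :: "nat set \<Rightarrow> (nat \<Rightarrow> real) \<Rightarrow> nat \<Rightarrow> real"
  where "zero_ext I x = (\<lambda>i. if i \<in> I then x i else 0)"

text \<open>Lebesgue measure on \<open>\<real>\<^sup>I\<close>, carried by the functions vanishing off \<open>I\<close>; being a Borel measure
  on the whole type, it avoids the extensional functions of \<^const>\<open>PiM\<close>.\<close>

definition vol :: "nat set \<Rightarrow> (nat \<Rightarrow> real) measure"
  where "vol I = distr (\<Pi>\<^sub>M i\<in>I. lborel) borel (zero_ext I)"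

lemma zero_ext_idem [simp]: "zero_ext I (zero_ext I x) = zero_ext I x"
  by (auto simp: zero_ext_def)

lemma zero_ext_upd: "i \<notin> I \<Longrightarrow> zero_ext (insert i I) (x(i := u)) = (zero_ext I x)(i := u)"
  by (auto simp: zero_ext_def)

lemma zero_ext_insert: "i \<notin> I \<Longrightarrow> zero_ext (insert i I) x = (zero_ext I x)(i := x i)"
  by (auto simp: zero_ext_def)

lemma zero_ext_Rn: "I \<subseteq> {..<n} \<Longrightarrow> zero_ext I x \<in> Rn n"
  by (auto simp: zero_ext_def Rn_iff)

lemma continuous_on_zero_ext: "continuous_on A (zero_ext I)"
  unfolding zero_ext_def
proof (intro continuous_on_coordinatewise_then_product)
  show "continuous_on A (\<lambda>x :: nat \<Rightarrow> real. if i \<in> I then x i else 0)" for i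
    by (cases "i \<in> I") (auto intro: continuous_on_subset[OF continuous_on_product_coordinates])
qed

lemma continuous_on_upd:
  fixes i :: nat
  shows "continuous_on A (\<lambda>(y :: nat \<Rightarrow> real, u). y(i := u))"
proof (intro continuous_on_coordinatewise_then_product)
  fix k
  have "continuous_on A (\<lambda>p :: (nat \<Rightarrow> real) \<times> real. fst p k)"
    using continuous_on_compose[OF continuous_on_fst[OF continuous_on_id]
        continuous_on_subset[OF continuous_on_product_coordinates[of k] subset_UNIV]]
    by (simp add: o_def)
  then show "continuous_on A (\<lambda>p. (case p of (y, u) \<Rightarrow> y(i := u)) k)"
    by (cases "k = i") (auto simp: case_prod_unfold intro: continuous_intros)
qed

lemma measurable_zero_ext [measurable]: "zero_ext I \<in> measurable (\<Pi>\<^sub>M i\<in>I. lborel) borel"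
proof -
  have "zero_ext I \<in> measurable (\<Pi>\<^sub>M i\<in>I. lborel) (\<Pi>\<^sub>M i\<in>UNIV. (borel :: real measure))"
    unfolding zero_ext_def
  proof (rule measurable_PiM_single')
    fix i :: nat
    show "(\<lambda>x. if i \<in> I then x i else 0) \<in> measurable (\<Pi>\<^sub>M i\<in>I. lborel) (borel :: real measure)"
      using measurable_component_singleton[of i I "\<lambda>_. lborel"] by (cases "i \<in> I") simp_all
  qed auto
  then show ?thesis
    using measurable_cong_sets[OF refl sets_PiM_equal_borel] by blast
qed

lemma sets_vol [simp, measurable_cong]: "sets (vol I) = sets borel"
  by (simp add: vol_def)

lemma space_vol [simp]: "space (vol I) = UNIV"
  by (simp add: vol_def)

lemma emeasure_vol:
  "B \<in> sets borel \<Longrightarrow> emeasure (vol I) B = emeasure (\<Pi>\<^sub>M i\<in>I. lborel) {x \<in> space (\<Pi>\<^sub>M i\<in>I. lborel). zero_ext I x \<in> B}"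
  by (simp add: vol_def emeasure_distr vimage_def Int_def conj_commute)

lemma measurable_line:
  fixes i :: nat
  assumes B: "B \<in> sets borel"
  shows "{u. y(i := u) \<in> B} \<in> sets (lborel :: real measure)"
proof -
  have "continuous_on UNIV (\<lambda>u. y(i := u))"
    using continuous_on_compose2[OF continuous_on_upd[of UNIV i], of UNIV "\<lambda>u. (y, u)"]
    by (simp add: continuous_intros)
  then have "(\<lambda>u. y(i := u)) \<in> borel_measurable borel" by (rule borel_measurable_continuous_onI)
  from measurable_sets[OF this B] show ?thesis by (simp add: vimage_def)
qed

lemma measurable_sections:
  fixes i :: nat and B :: "(nat \<Rightarrow> real) set"
  assumes "B \<in> sets borel"
  shows "(\<lambda>y. emeasure lborel {u. y(i := u) \<in> B}) \<in> borel_measurable borel"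
proof -
  have "(\<lambda>(y :: nat \<Rightarrow> real, u :: real). y(i := u)) \<in> borel_measurable (borel :: ((nat \<Rightarrow> real) \<times> real) measure)"
    by (intro borel_measurable_continuous_onI continuous_on_upd)
  from measurable_sets[OF this assms]
  have "{(y, u). y(i := u) \<in> B} \<in> sets (borel \<Otimes>\<^sub>M lborel)"
    by (simp add: vimage_def case_prod_unfold borel_prod[symmetric] space_pair_measure cong: sets_pair_measure_cong)
  from lborel.measurable_emeasure_Pair[OF this] show ?thesis
    by (simp add: vimage_def)
qed

text \<open>Tonelli, integrating first along the lines parallel to axis \<open>i\<close>.\<close>

lemma emeasure_vol_insert:
  assumes "finite I" "i \<notin> I" and B: "B \<in> sets borel"
  shows "emeasure (vol (insert i I)) B = (\<integral>\<^sup>+y. emeasure lborel {u. y(i := u) \<in> B} \<partial>vol I)"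
proof -
  interpret product_sigma_finite "\<lambda>_ :: nat. lborel :: real measure" by standard
  let ?J = "insert i I"
  have "emeasure (vol ?J) B = (\<integral>\<^sup>+x. indicator B x \<partial>vol ?J)"
    using B by simp
  also have "\<dots> = (\<integral>\<^sup>+x. indicator B (zero_ext ?J x) \<partial>(\<Pi>\<^sub>M i\<in>?J. lborel))"
    unfolding vol_def using B by (intro nn_integral_distr) auto
  also have "\<dots> = (\<integral>\<^sup>+x. (\<integral>\<^sup>+u. indicator B (zero_ext ?J (x(i := u))) \<partial>lborel) \<partial>(\<Pi>\<^sub>M i\<in>I. lborel))"
    using B measurable_zero_ext by (intro product_nn_integral_insert assms(1,2)) auto
  also have "\<dots> = (\<integral>\<^sup>+x. emeasure lborel {u. (zero_ext I x)(i := u) \<in> B} \<partial>(\<Pi>\<^sub>M i\<in>I. lborel))"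
  proof (intro nn_integral_cong)
    fix x
    have "(\<integral>\<^sup>+u. indicator B (zero_ext ?J (x(i := u))) \<partial>lborel) =
        (\<integral>\<^sup>+u. indicator {u. (zero_ext I x)(i := u) \<in> B} u \<partial>lborel)"
      using assms(2) by (simp add: zero_ext_upd indicator_def)
    then show "(\<integral>\<^sup>+u. indicator B (zero_ext ?J (x(i := u))) \<partial>lborel) = emeasure lborel {u. (zero_ext I x)(i := u) \<in> B}"
      using measurable_line[OF B] by simp
  qed
  also have "\<dots> = (\<integral>\<^sup>+y. emeasure lborel {u. y(i := u) \<in> B} \<partial>vol I)"
    unfolding vol_def using measurable_sections[OF B]
    by (intro nn_integral_distr[symmetric]) auto
  finally show ?thesis .
qed

lemma emeasure_closure_eq_interior:
  assumes "emeasure (vol I) (frontier A) = 0"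
  shows "emeasure (vol I) (closure A) = emeasure (vol I) (interior A)"
proof -
  have "frontier A \<in> null_sets (vol I)" using assms by (auto simp: null_sets_def)
  moreover have "closure A = interior A \<union> frontier A"
    using interior_subset closure_subset by (auto simp: frontier_def)
  ultimately show ?thesis using emeasure_Un_null_set[of "interior A" "vol I"] by simp
qed

text \<open>\<open>E\<close> consists of the preimage of the interior, which is measurable, and a
  part of the preimage of the frontier, which is null in the completion.\<close>

lemma lebesgue_PiM_of_null_frontier:
  assumes "emeasure (vol I) (frontier (zero_ext I -` D)) = 0"
  defines "E \<equiv> {y \<in> space (\<Pi>\<^sub>M i\<in>I. lborel). zero_ext I y \<in> D}"
  shows "E \<in> sets (lebesgue_PiM I)"
    and "emeasure (lebesgue_PiM I) E = emeasure (vol I) (interior (zero_ext I -` D))"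
proof -
  let ?M = "\<Pi>\<^sub>M i\<in>I. (lborel :: real measure)"
  let ?pre = "\<lambda>B. {y \<in> space ?M. zero_ext I y \<in> B}"
  have pre_sets: "?pre B \<in> sets ?M" if "B \<in> sets borel" for B
    using measurable_sets[OF measurable_zero_ext that] by (simp add: vimage_def Int_def conj_commute)
  let ?A = "zero_ext I -` D"
  have "?pre (frontier ?A) \<in> null_sets ?M"
    using assms(1) pre_sets[of "frontier ?A"] by (simp add: null_sets_def emeasure_vol)
  then have null: "E \<inter> ?pre (frontier ?A) \<in> null_sets (completion ?M)"
    using null_sets_completion_subset[of "E \<inter> ?pre (frontier ?A)" "?pre (frontier ?A)" ?M]
      null_sets_completionI by blast
  have int: "?pre (interior ?A) \<in> sets ?M" by (intro pre_sets) simp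
  have "E \<subseteq> ?pre (interior ?A) \<union> E \<inter> ?pre (frontier ?A)"
    using closure_subset[of ?A] by (auto simp: E_def frontier_def)
  moreover have "?pre (interior ?A) \<subseteq> E"
    using interior_subset[of ?A] by (auto simp: E_def)
  ultimately have E: "E = ?pre (interior ?A) \<union> E \<inter> ?pre (frontier ?A)" by blast
  show "E \<in> sets (lebesgue_PiM I)"
    unfolding lebesgue_PiM_def using null int by (subst E) (auto simp: null_sets_def)
  show "emeasure (lebesgue_PiM I) E = emeasure (vol I) (interior (zero_ext I -` D))"
    unfolding lebesgue_PiM_def using null int
    by (subst E, subst emeasure_Un_null_set) (auto simp: emeasure_vol)
qed

section \<open>Definable sets have null frontier\<close>

context semialgebraic_o_minimal
begin

text \<open>Induction on the set of axes, with the ambient \<open>n\<close> fixed. Over almost every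
  base point, the frontier of the cylinder meets the line in direction \<open>i\<close> only in the
  frontier of the section of \<open>D\<close>, which is finite; Tonelli then gives measure
  zero.\<close>

theorem null_frontier:
  assumes "finite I" "I \<subseteq> {..<n}" "0 < n" "D \<in> S n"
  shows "emeasure (vol I) (frontier (zero_ext I -` D)) = 0"
  using assms(1,2,4)
proof (induction I arbitrary: D rule: finite_induct)
  case empty
  have "zero_ext {} -` D = {} \<or> zero_ext {} -` D = UNIV" by (auto simp: zero_ext_def)
  then have "frontier (zero_ext {} -` D) = {}" by auto
  then show ?case by simp
next
  case (insert i I)
  have i: "i < n" "i \<notin> I" and I: "I \<subseteq> {..<n}" using insert.prems insert.hyps by auto
  \<comment> \<open>The base points over which the whole open segment from \<open>p\<close> to
    \<open>q\<close> lies in \<open>A\<close>. They form a definable set, so the induction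
    hypothesis covers the frontier of its cylinder over \<open>I\<close>.\<close>
  define U where "U A p q = {y \<in> Rn n. \<forall>u. p < u \<and> u < q \<longrightarrow> y(i := u) \<in> A}" for A :: "(nat \<Rightarrow> real) set" and p q
  have U: "U A p q \<in> S n" if "A \<in> S n" for A p q
  proof -
    have "definable n (\<lambda>y. \<forall>u. p < u \<and> u < q \<longrightarrow> y(i := u) \<in> A)"
    proof (intro definable_intros \<open>0 < n\<close>)
      show "definable (Suc n) (\<lambda>x. (x(n := 0))(i := x n) \<in> A)"
        using that \<open>0 < n\<close> i(1)
        by (intro definable_subst) (auto intro!: polynomial_if polynomial_on_Rn.intros simp: Rn_iff)
    qed simp_all
    then show ?thesis by (simp add: U_def definable_def)
  qed
  have D': "Rn n - D \<in> S n" using insert.prems complement \<open>0 < n\<close> by simp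
  \<comment> \<open>Rational endpoints suffice to enclose any given height, so the exceptional base
    points form a countable union of null sets.\<close>
  define F where "F = (\<Union>p\<in>\<rat>. \<Union>q\<in>\<rat>. frontier (zero_ext I -` U D p q) \<union> frontier (zero_ext I -` U (Rn n - D) p q))"
  have F_null: "F \<in> null_sets (vol I)"
    unfolding F_def using insert.IH[OF I] U[OF D'] U[OF insert.prems(2)]
    by (intro null_sets_UN' null_sets.Un countable_rat) (auto simp: null_sets_def)
  let ?A = "zero_ext (insert i I) -` D"
  \<comment> \<open>Otherwise a rational segment around \<open>x i\<close> lies in the section of
    \<open>D\<close> or of its complement. Off \<open>F\<close> the base point is interior to the
    corresponding \<open>U\<close>, and the product of a neighborhood of it with the segment makes
    \<open>x\<close> interior to the cylinder or to its complement.\<close>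
  have key: "x i \<in> frontier {u. (zero_ext I x)(i := u) \<in> D}"
    if x: "x \<in> frontier ?A" "zero_ext I x \<notin> F" for x
  proof (rule ccontr)
    assume "x i \<notin> frontier {u. (zero_ext I x)(i := u) \<in> D}"
    then have *: "x i \<in> interior {u. (zero_ext I x)(i := u) \<in> D} \<union> interior (- {u. (zero_ext I x)(i := u) \<in> D})"
      by (auto simp: frontier_def interior_closure)
    have nbhd: "\<exists>N. open N \<and> x \<in> N \<and> N \<subseteq> {x. zero_ext (insert i I) x \<in> A}"
      if A: "A = D \<or> A = Rn n - D" and xi: "x i \<in> interior {u. (zero_ext I x)(i := u) \<in> A}" for A
    proof -
      obtain e where e: "e > 0" "\<And>u. \<bar>u - x i\<bar> < e \<Longrightarrow> (zero_ext I x)(i := u) \<in> A"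
        using xi by (auto simp: mem_interior ball_def dist_real_def abs_minus_commute subset_iff)
      obtain p where p: "p \<in> \<rat>" "x i - e < p" "p < x i"
        using Rats_dense_in_real[of "x i - e" "x i"] e(1) by auto
      obtain q where q: "q \<in> \<rat>" "x i < q" "q < x i + e"
        using Rats_dense_in_real[of "x i" "x i + e"] e(1) by auto
      have m: "zero_ext I x \<in> zero_ext I -` U A p q"
        using e(2) p q zero_ext_Rn[OF I] by (auto simp: U_def)
      have m': "zero_ext I x \<notin> frontier (zero_ext I -` U A p q)"
        using x(2) p(1) q(1) A unfolding F_def by blast
      have "zero_ext I x \<in> interior (zero_ext I -` U A p q)"
        by (rule ccontr) (rule notE[OF m' mem_frontierI[OF m]])
      let ?O = "zero_ext I -` interior (zero_ext I -` U A p q) \<inter> {x. x i \<in> {p<..<q}}"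
      have "open ?O"
      proof (intro open_Int open_vimage continuous_on_zero_ext open_interior)
        have "open ((\<lambda>x :: nat \<Rightarrow> real. x i) -` {p<..<q})"
          by (intro open_vimage continuous_on_product_coordinates) simp
        then show "open {x :: nat \<Rightarrow> real. x i \<in> {p<..<q}}" by (simp add: vimage_def)
      qed
      moreover have "x \<in> ?O" using \<open>zero_ext I x \<in> interior _\<close> p q by simp
      moreover have "?O \<subseteq> {x. zero_ext (insert i I) x \<in> A}"
        using interior_subset[of "zero_ext I -` U A p q"] i(2) by (auto simp: U_def zero_ext_insert)
      ultimately show ?thesis by blast
    qed
    from * show False
    proof
      assume "x i \<in> interior {u. (zero_ext I x)(i := u) \<in> D}"
      from nbhd[OF _ this] have "x \<in> interior ?A" by (auto simp: interior_def vimage_def)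
      with x(1) show False by (simp add: frontier_def)
    next
      assume "x i \<in> interior (- {u. (zero_ext I x)(i := u) \<in> D})"
      moreover have "- {u. (zero_ext I x)(i := u) \<in> D} = {u. (zero_ext I x)(i := u) \<in> Rn n - D}"
        using zero_ext_Rn[OF I] i(1) by (auto intro: Rn_upd)
      ultimately have "x i \<in> interior {u. (zero_ext I x)(i := u) \<in> Rn n - D}" by simp
      from nbhd[OF _ this] have "x \<in> interior (- ?A)" by (auto simp: interior_def)
      with x(1) show False by (simp add: frontier_def interior_complement)
    qed
  qed
  have zero: "emeasure lborel {u. (zero_ext I y)(i := u) \<in> frontier ?A} = 0" if "zero_ext I y \<notin> F" for y
  proof -
    have "{u. (zero_ext I y)(i := u) \<in> frontier ?A} \<subseteq> frontier {u. (zero_ext I y)(i := u) \<in> D}"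
    proof
      fix u assume u: "u \<in> {u. (zero_ext I y)(i := u) \<in> frontier ?A}"
      have "zero_ext I ((zero_ext I y)(i := u)) = zero_ext I y" using i(2) by (auto simp: zero_ext_def)
      then show "u \<in> frontier {u. (zero_ext I y)(i := u) \<in> D}"
        using key[of "(zero_ext I y)(i := u)"] u that by simp
    qed
    moreover have "finite (frontier {u. (zero_ext I y)(i := u) \<in> D})"
    proof (rule finite_frontier_line)
      have "{x \<in> Rn n. x \<in> D} = D" using carrier[of n D] insert.prems \<open>0 < n\<close> by auto
      then show "definable n (\<lambda>x. x \<in> D)" using insert.prems \<open>0 < n\<close> by (simp add: definable_def)
    qed (use i zero_ext_Rn[OF I] in auto)
    ultimately have "finite {u. (zero_ext I y)(i := u) \<in> frontier ?A}" by (rule finite_subset)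
    then show ?thesis by (simp add: emeasure_lborel_countable uncountable_infinite countable_finite)
  qed
  \<comment> \<open>\<open>vol I\<close> is carried by the functions vanishing off \<open>I\<close>,
    so \<open>zero\<close> speaks about almost every \<open>y\<close> itself.\<close>
  have "AE y in vol I. zero_ext I y = y"
    unfolding vol_def
    using borel_closed[OF closed_Collect_eq[OF continuous_on_zero_ext continuous_on_id]]
    by (subst AE_distr_iff) auto
  with AE_not_in[OF F_null]
  have "AE y in vol I. emeasure lborel {u. y(i := u) \<in> frontier ?A} = 0"
  proof eventually_elim
    case (elim y)
    with zero[of y] show ?case by simp
  qed
  then have "(\<integral>\<^sup>+y. emeasure lborel {u. y(i := u) \<in> frontier ?A} \<partial>vol I) = 0"
    using measurable_sections[of "frontier ?A" i] by (subst nn_integral_0_iff_AE) auto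
  then show ?case using emeasure_vol_insert[OF insert.hyps, of "frontier ?A"] by simp
qed

end

section \<open>Linear images\<close>

text \<open>With a representative chosen in each signature class, the values of \<open>l\<close> on
  the class lie in an interval of length \<open>2 * R\<close> centered at the value of the
  representative.\<close>

lemma emeasure_image_le:
  fixes l :: "'a \<Rightarrow> real" and sig :: "'a \<Rightarrow> 'b"
  assumes fin: "finite (sig ` E)" "card (sig ` E) \<le> K"
    and close: "\<And>x y. x \<in> E \<Longrightarrow> y \<in> E \<Longrightarrow> sig x = sig y \<Longrightarrow> ennreal \<bar>l x - l y\<bar> \<le> R"
    and G: "G \<subseteq> l ` E"
  shows "emeasure lborel G \<le> of_nat K * (2 * R)"
proof (cases "E = {}")
  case True
  then show ?thesis using G by simp
next
  case False
  then have "K \<noteq> 0" using fin by (auto simp: card_gt_0_iff)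
  show ?thesis
  proof (cases R)
    case top
    \<comment> \<open>A positive \<open>K\<close> makes the right side infinite; for
      \<open>K = 0\<close> the product would be 0.\<close>
    then show ?thesis using \<open>K \<noteq> 0\<close> by (simp add: ennreal_mult_eq_top_iff ennreal_mult_top)
  next
    case (real r)
    define c where "c s = l (SOME x. x \<in> E \<and> sig x = s)" for s
    have "G \<subseteq> (\<Union>s\<in>sig ` E. {c s - r..c s + r})"
    proof
      fix g assume "g \<in> G"
      then obtain x where x: "x \<in> E" "g = l x" using G by blast
      define y where "y = (SOME y. y \<in> E \<and> sig y = sig x)"
      have y: "y \<in> E \<and> sig y = sig x" unfolding y_def by (rule someI[of _ x]) (use x in auto)
      have "\<bar>l x - l y\<bar> \<le> r"
        using close[of x y] x(1) y real by (simp add: ennreal_le_iff)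
      then have "g \<in> {c (sig x) - r..c (sig x) + r}"
        unfolding c_def y_def[symmetric] x(2) by (auto simp: abs_le_iff)
      then show "g \<in> (\<Union>s\<in>sig ` E. {c s - r..c s + r})" using x(1) by blast
    qed
    then have "emeasure lborel G \<le> emeasure lborel (\<Union>s\<in>sig ` E. {c s - r..c s + r})"
      using fin(1) by (intro emeasure_mono sets.finite_UN) auto
    also have "\<dots> \<le> (\<Sum>s\<in>sig ` E. emeasure lborel {c s - r..c s + r})"
      using fin(1) by (intro emeasure_subadditive_finite) auto
    also have "\<dots> = (\<Sum>s\<in>sig ` E. 2 * R)"
      using real by (intro sum.cong) (auto simp: ennreal_mult)
    also have "\<dots> = of_nat (card (sig ` E)) * (2 * R)" by simp
    also have "\<dots> \<le> of_nat K * (2 * R)"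
      using fin(2) by (intro mult_right_mono) auto
    finally show ?thesis .
  qed
qed

text \<open>The segment between \<open>u\<close> and \<open>v\<close> misses the frontier of
  \<open>P\<close>, so by connectedness it lies in \<open>P\<close>. For \<open>u < v\<close> the
  non-strict sets exclude frontier points above \<open>u\<close>, and the strict ones exclude
  \<open>u\<close> itself.\<close>

lemma segment_same_signature:
  fixes P :: "real set"
  assumes uv: "u \<in> P" "v \<in> P"
    and lt: "{f \<in> frontier P. f < u} = {f \<in> frontier P. f < v}"
    and le: "{f \<in> frontier P. f \<le> u} = {f \<in> frontier P. f \<le> v}"
    and Q: "P \<subseteq> Q" "Q \<in> sets lborel"
  shows "ennreal \<bar>u - v\<bar> \<le> emeasure lborel Q"
proof -
  have *: "ennreal (v - u) \<le> emeasure lborel Q"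
    if h: "u < v" "u \<in> P" "v \<in> P" "{f \<in> frontier P. f < u} = {f \<in> frontier P. f < v}"
      "{f \<in> frontier P. f \<le> u} = {f \<in> frontier P. f \<le> v}" for u v
  proof -
    have "f \<notin> frontier P" if f: "u \<le> f" "f \<le> v" for f
    proof
      assume "f \<in> frontier P"
      then have "f \<in> {f \<in> frontier P. f \<le> u}" unfolding h(5) using f by simp
      then have "f \<in> {f \<in> frontier P. f < v}" using h(1) by simp
      then have "f < u" unfolding h(4)[symmetric] by simp
      with f show False by simp
    qed
    then have "{u..v} \<inter> frontier P = {}" by auto
    moreover have "u \<in> {u..v} \<inter> P" using h by simp
    ultimately have "{u..v} \<subseteq> P"
      using connected_Int_frontier[OF connected_Icc, of u v P] by blast
    then have "emeasure lborel {u..v} \<le> emeasure lborel Q"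
      using Q by (intro emeasure_mono) auto
    then show ?thesis using h by simp
  qed
  consider "u < v" | "u = v" | "v < u" by linarith
  then show ?thesis
  proof cases
    case 1
    then show ?thesis using *[of u v] assms by simp
  next
    case 3
    then show ?thesis using *[of v u] assms by simp
  qed simp
qed

text \<open>The interval components of the coordinate projections cut \<open>E\<close> into boundedly many pieces,
  each of which lies in a box whose sides are bounded by the measures of the projections.\<close>

lemma emeasure_linear_image_le:
  fixes E :: "(nat \<Rightarrow> real) set"
  assumes a: "\<And>i. i < n \<Longrightarrow> \<bar>a i\<bar> \<le> 1"
    and fin: "\<And>i. i < n \<Longrightarrow> finite (frontier ((\<lambda>x. x i) ` E))"
    and N: "\<And>i. i < n \<Longrightarrow> card (frontier ((\<lambda>x. x i) ` E)) \<le> N"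
    and Q: "\<And>i. i < n \<Longrightarrow> (\<lambda>x. x i) ` E \<subseteq> Q i" "\<And>i. i < n \<Longrightarrow> Q i \<in> sets lborel"
    and G: "G \<subseteq> (\<lambda>x. \<Sum>i<n. a i * x i) ` E"
  shows "emeasure lborel G \<le> of_nat (4 ^ (N * n)) * (2 * (\<Sum>i<n. emeasure lborel (Q i)))"
proof -
  let ?F = "\<lambda>i. frontier ((\<lambda>x. x i) ` E)"
  \<comment> \<open>The signature locates each coordinate relative to the frontier of its
    projection. Two subsets of at most \<open>N\<close> points give at most \<open>4 ^ N\<close>
    possibilities per coordinate, hence the factor \<open>4 ^ (N * n)\<close>.\<close>
  define sig where "sig x = (\<lambda>i\<in>{..<n}. ({f \<in> ?F i. f < x i}, {f \<in> ?F i. f \<le> x i}))" for x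
  let ?P = "\<Pi>\<^sub>E i\<in>{..<n}. Pow (?F i) \<times> Pow (?F i)"
  have finP: "finite ?P" using fin by (intro finite_PiE) auto
  have sub: "sig ` E \<subseteq> ?P" unfolding sig_def by (intro image_subsetI restrict_PiE_iff[THEN iffD2]) auto
  have "card ?P = (\<Prod>i<n. card (Pow (?F i) \<times> Pow (?F i)))" by (simp add: card_PiE)
  also have "\<dots> \<le> (\<Prod>i<n. 4 ^ N)"
  proof (intro prod_mono conjI)
    fix i assume "i \<in> {..<n}"
    then have "card (Pow (?F i) \<times> Pow (?F i)) = 4 ^ card (?F i)"
      using fin by (simp add: card_cartesian_product card_Pow power_mult_distrib[symmetric])
    also have "\<dots> \<le> (4 :: nat) ^ N" using N \<open>i \<in> {..<n}\<close> by (intro power_increasing) auto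
    finally show "card (Pow (?F i) \<times> Pow (?F i)) \<le> 4 ^ N" .
  qed simp
  also have "\<dots> = 4 ^ (N * n)" by (simp add: power_mult)
  finally have card: "card (sig ` E) \<le> 4 ^ (N * n)" using card_mono[OF finP sub] by simp
  show ?thesis
  proof (rule emeasure_image_le[OF finite_subset[OF sub finP] card _ G])
    fix x y assume xy: "x \<in> E" "y \<in> E" "sig x = sig y"
    have *: "ennreal \<bar>x i - y i\<bar> \<le> emeasure lborel (Q i)" if i: "i < n" for i
    proof (rule segment_same_signature[of _ "(\<lambda>x. x i) ` E"])
      have "sig x i = sig y i" using xy by simp
      then show "{f \<in> ?F i. f < x i} = {f \<in> ?F i. f < y i}" "{f \<in> ?F i. f \<le> x i} = {f \<in> ?F i. f \<le> y i}"
        using i by (auto simp: sig_def)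
    qed (use xy Q i in auto)
    have "\<bar>(\<Sum>i<n. a i * x i) - (\<Sum>i<n. a i * y i)\<bar> = \<bar>\<Sum>i<n. a i * (x i - y i)\<bar>"
      by (simp add: sum_subtractf right_diff_distrib)
    also have "\<dots> \<le> (\<Sum>i<n. \<bar>a i * (x i - y i)\<bar>)" by (rule sum_abs)
    also have "\<dots> \<le> (\<Sum>i<n. \<bar>x i - y i\<bar>)"
      using a by (intro sum_mono) (auto simp: abs_mult intro: mult_left_le_one_le)
    finally have "ennreal \<bar>(\<Sum>i<n. a i * x i) - (\<Sum>i<n. a i * y i)\<bar> \<le> ennreal (\<Sum>i<n. \<bar>x i - y i\<bar>)"
      by (rule ennreal_leI)
    also have "\<dots> = (\<Sum>i<n. ennreal \<bar>x i - y i\<bar>)" by (simp add: sum_ennreal)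
    also have "\<dots> \<le> (\<Sum>i<n. emeasure lborel (Q i))" using * by (intro sum_mono) auto
    finally show "ennreal \<bar>(\<Sum>i<n. a i * x i) - (\<Sum>i<n. a i * y i)\<bar> \<le> (\<Sum>i<n. emeasure lborel (Q i))" .
  qed
qed

section \<open>Linear maps and renaming of coordinates\<close>

definition Lmap :: "nat \<Rightarrow> nat \<Rightarrow> (nat \<Rightarrow> nat \<Rightarrow> real) \<Rightarrow> (nat \<Rightarrow> real) \<Rightarrow> nat \<Rightarrow> real"
  where "Lmap n j M x = (\<lambda>k. if k < j then \<Sum>i<n. M k i * x i else 0)"

text \<open>The interior replaces the image, which need not be a Borel set.\<close>

definition image_vol :: "nat \<Rightarrow> nat \<Rightarrow> (nat \<Rightarrow> nat \<Rightarrow> real) \<Rightarrow> (nat \<Rightarrow> real) set \<Rightarrow> ennreal"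
  where "image_vol n j M A = emeasure (vol {..<j}) (interior (zero_ext {..<j} -` (Lmap n j M ` A)))"

definition unit :: "nat \<Rightarrow> nat \<Rightarrow> real"
  where "unit i = (\<lambda>k. if k = i then 1 else 0)"

lemma sum_unit: "i < n \<Longrightarrow> (\<Sum>k<n. unit i k * x k) = x i"
  by (simp add: unit_def if_distrib[of "\<lambda>c. c * _"] cong: if_cong)

lemma Lmap_Rn: "Lmap n j M x \<in> Rn j"
  by (simp add: Lmap_def Rn_iff)

text \<open>Renaming coordinates preserves the measure of boxes, which determines the product
  measure. Needed for choices of axes that are not listed in increasing order.\<close>

lemma distr_PiM_lborel_reindex:
  assumes c: "inj_on c J" "finite J"
  shows "distr (\<Pi>\<^sub>M i\<in>c ` J. (lborel :: real measure)) (\<Pi>\<^sub>M l\<in>J. lborel) (\<lambda>y. \<lambda>l\<in>J. y (c l)) =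
    (\<Pi>\<^sub>M l\<in>J. lborel)"
proof -
  interpret product_sigma_finite "\<lambda>_. lborel :: real measure" by standard
  let ?f = "\<lambda>y. \<lambda>l\<in>J. y (c l)"
  have f: "?f \<in> measurable (\<Pi>\<^sub>M i\<in>c ` J. lborel) (\<Pi>\<^sub>M l\<in>J. lborel)"
    by (intro measurable_restrict measurable_component_singleton) auto
  show ?thesis
  proof (rule PiM_eqI[OF c(2)])
    fix A :: "'a \<Rightarrow> real set" assume A: "\<And>i. i \<in> J \<Longrightarrow> A i \<in> sets lborel"
    let ?B = "\<lambda>i. A (the_inv_into J c i)"
    have inv: "the_inv_into J c (c l) = l" if "l \<in> J" for l
      by (rule the_inv_into_f_f[OF c(1) that])
    have "?f -` (Pi\<^sub>E J A) \<inter> space (\<Pi>\<^sub>M i\<in>c ` J. lborel) = Pi\<^sub>E (c ` J) ?B"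
      by (auto simp: space_PiM PiE_def Pi_def inv)
    then have "emeasure (distr (\<Pi>\<^sub>M i\<in>c ` J. lborel) (\<Pi>\<^sub>M l\<in>J. lborel) ?f) (Pi\<^sub>E J A) =
        emeasure (\<Pi>\<^sub>M i\<in>c ` J. lborel) (Pi\<^sub>E (c ` J) ?B)"
      using A f c(2) by (subst emeasure_distr) (auto intro!: sets_PiM_I_finite)
    also have "\<dots> = (\<Prod>i\<in>c ` J. emeasure lborel (?B i))"
      using A c(2) inv by (intro emeasure_PiM) auto
    also have "\<dots> = (\<Prod>l\<in>J. emeasure lborel (A l))"
      using inv by (simp add: prod.reindex[OF c(1)])
    finally show "emeasure (distr (\<Pi>\<^sub>M i\<in>c ` J. lborel) (\<Pi>\<^sub>M l\<in>J. lborel) ?f) (Pi\<^sub>E J A) = \<dots>" .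
  qed simp
qed

lemma emeasure_vol_diagonal:
  assumes "finite I" "a \<in> I" "a \<noteq> b"
  shows "emeasure (vol I) {x. x a = x b} = 0"
proof -
  have B: "{x :: nat \<Rightarrow> real. x a = x b} \<in> sets borel"
    by (intro borel_closed closed_Collect_eq continuous_on_product_coordinates)
  have "{u. (y(a := u)) a = (y(a := u)) b} = {y b}" for y :: "nat \<Rightarrow> real"
    using assms by auto
  then show ?thesis
    using emeasure_vol_insert[of "I - {a}" a, OF _ _ B] assms by (simp add: insert_absorb)
qed

section \<open>Replacing linear functionals by coordinates\<close>

context semialgebraic_o_minimal
begin

lemma Lmap_image_definable:
  assumes "A \<in> S n" "0 < n" "0 < j"
  shows "Lmap n j M ` A \<in> S j"
proof (intro definable_image[OF assms] Lmap_Rn)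
  show "polynomial_on_Rn n (\<lambda>x. Lmap n j M x i)" for i
    unfolding Lmap_def by (intro polynomial_intros) auto
qed

text \<open>The image is definable, so its frontier is null. This allows the interior as a Borel set
  inside the image and the closure as one containing it, with equal volume.\<close>

lemma image_vol_eq_closure:
  assumes "A \<in> S n" "0 < n" "0 < j"
  shows "image_vol n j M A = emeasure (vol {..<j}) (closure (zero_ext {..<j} -` (Lmap n j M ` A)))"
  unfolding image_vol_def
  using null_frontier[OF _ _ assms(3) Lmap_image_definable[OF assms], of "{..<j}" M]
  by (simp add: emeasure_closure_eq_interior)

text \<open>Fubini over the \<open>k\<close>-th coordinate reduces the replacement of one row by unit vectors to a
  statement about the linear images of the fibers in \<open>\<real>\<close>.\<close>

lemma image_vol_replace_row:
  assumes A: "A \<in> S n" "0 < n" and k: "k < j" and M: "\<And>i. i < n \<Longrightarrow> \<bar>M k i\<bar> \<le> 1"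
    and fin: "\<And>i y. i < n \<Longrightarrow> finite (frontier ((\<lambda>x. x i) `
      {x \<in> A. \<forall>l<j. l \<noteq> k \<longrightarrow> (\<Sum>i<n. M l i * x i) = y l}))"
    and N: "\<And>i y. i < n \<Longrightarrow> card (frontier ((\<lambda>x. x i) `
      {x \<in> A. \<forall>l<j. l \<noteq> k \<longrightarrow> (\<Sum>i<n. M l i * x i) = y l})) \<le> N"
  shows "image_vol n j M A \<le> of_nat (4 ^ (N * n)) * (2 * (\<Sum>i<n. image_vol n j (M(k := unit i)) A))"
proof -
  let ?I = "{..<j} - {k}"
  let ?O = "interior (zero_ext {..<j} -` (Lmap n j M ` A))"
  let ?C = "\<lambda>i. closure (zero_ext {..<j} -` (Lmap n j (M(k := unit i)) ` A))"
  have j: "insert k ?I = {..<j}" "0 < j" using k by auto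
  have fub: "emeasure (vol {..<j}) B = (\<integral>\<^sup>+y. emeasure lborel {u. y(k := u) \<in> B} \<partial>vol ?I)"
    if "B \<in> sets borel" for B
    using emeasure_vol_insert[of ?I k, OF _ _ that] j by simp
  have le: "emeasure lborel {u. y(k := u) \<in> ?O} \<le>
      of_nat (4 ^ (N * n)) * (2 * (\<Sum>i<n. emeasure lborel {u. y(k := u) \<in> ?C i}))" for y
  proof (rule emeasure_linear_image_le[where a = "M k"])
    \<comment> \<open>The part of \<open>A\<close> where the other functionals have the values
      prescribed by \<open>y\<close>. Row \<open>k\<close> maps it onto a set containing the section
      of \<open>?O\<close>, and coordinate \<open>i\<close> maps it into the section of
      \<open>?C i\<close>, so the estimate on the line applies.\<close>
    let ?E = "{x \<in> A. \<forall>l<j. l \<noteq> k \<longrightarrow> (\<Sum>i<n. M l i * x i) = y l}"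
    show "{u. y(k := u) \<in> ?O} \<subseteq> (\<lambda>x. \<Sum>i<n. M k i * x i) ` ?E"
    proof
      fix u assume "u \<in> {u. y(k := u) \<in> ?O}"
      then have "zero_ext {..<j} (y(k := u)) \<in> Lmap n j M ` A" using interior_subset by blast
      then obtain x where x: "x \<in> A" "zero_ext {..<j} (y(k := u)) = Lmap n j M x" by blast
      have "(y(k := u)) l = (\<Sum>i<n. M l i * x i)" if "l < j" for l
        using fun_cong[OF x(2), of l] that by (simp add: zero_ext_def Lmap_def)
      then have "u = (\<Sum>i<n. M k i * x i)" "x \<in> ?E" using k x(1) by force+
      then show "u \<in> (\<lambda>x. \<Sum>i<n. M k i * x i) ` ?E" by blast
    qed
    fix i assume i: "i < n"
    show "(\<lambda>x. x i) ` ?E \<subseteq> {u. y(k := u) \<in> ?C i}"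
    proof (clarify)
      fix x assume x: "x \<in> A" "\<forall>l<j. l \<noteq> k \<longrightarrow> (\<Sum>i<n. M l i * x i) = y l"
      have "zero_ext {..<j} (y(k := x i)) = Lmap n j (M(k := unit i)) x"
        using x(2) i by (auto simp: zero_ext_def Lmap_def sum_unit fun_eq_iff)
      then show "y(k := x i) \<in> ?C i" using x(1) closure_subset by fastforce
    qed
    show "{u. y(k := u) \<in> ?C i} \<in> sets lborel" by (intro measurable_line) simp
  qed (use M fin N in auto)
  have "image_vol n j M A = (\<integral>\<^sup>+y. emeasure lborel {u. y(k := u) \<in> ?O} \<partial>vol ?I)"
    unfolding image_vol_def by (intro fub) simp
  also have "\<dots> \<le> (\<integral>\<^sup>+y. of_nat (4 ^ (N * n)) *
      (2 * (\<Sum>i<n. emeasure lborel {u. y(k := u) \<in> ?C i})) \<partial>vol ?I)"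
    by (intro nn_integral_mono le)
  also have "\<dots> = of_nat (4 ^ (N * n)) *
      (2 * (\<Sum>i<n. \<integral>\<^sup>+y. emeasure lborel {u. y(k := u) \<in> ?C i} \<partial>vol ?I))"
    using measurable_sections[of "?C i" k for i]
    by (subst nn_integral_cmult, simp, subst nn_integral_cmult, simp, subst nn_integral_sum) simp_all
  also have "\<dots> = of_nat (4 ^ (N * n)) * (2 * (\<Sum>i<n. image_vol n j (M(k := unit i)) A))"
    using A j by (simp add: fub[symmetric] image_vol_eq_closure)
  finally show ?thesis .
qed

text \<open>Rows are replaced one after another. Each replacement costs the factor
  \<open>4 ^ (N * n) * 2\<close> and a sum over \<open>n\<close> unit vectors; the bounds on
  frontiers range over all \<open>M\<close> since the other rows change meanwhile.\<close>

lemma image_vol_le_units: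
  assumes A: "A \<in> S n" "0 < n"
    and fin: "\<And>M k i y. i < n \<Longrightarrow> k < j \<Longrightarrow> finite (frontier ((\<lambda>x. x i) `
      {x \<in> A. \<forall>l<j. l \<noteq> k \<longrightarrow> (\<Sum>i<n. M l i * x i) = y l}))"
    and N: "\<And>M k i y. i < n \<Longrightarrow> k < j \<Longrightarrow> card (frontier ((\<lambda>x. x i) `
      {x \<in> A. \<forall>l<j. l \<noteq> k \<longrightarrow> (\<Sum>i<n. M l i * x i) = y l})) \<le> N"
    and units: "\<And>c. (\<And>l. l < j \<Longrightarrow> c l < n) \<Longrightarrow> image_vol n j (\<lambda>l. unit (c l)) A \<le> K"
    and M: "\<And>l i. l < j \<Longrightarrow> i < n \<Longrightarrow> \<bar>M l i\<bar> \<le> 1"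
  shows "image_vol n j M A \<le> of_nat (4 ^ (N * n) * 2 * n) ^ j * K"
proof -
  let ?C = "of_nat (4 ^ (N * n) * 2 * n) :: ennreal"
  \<comment> \<open>\<open>r\<close> counts the rows still to be replaced: those from index
    \<open>r\<close> on are already unit vectors.\<close>
  have "image_vol n j M A \<le> ?C ^ r * K"
    if "r \<le> j" "\<And>l i. l < j \<Longrightarrow> i < n \<Longrightarrow> \<bar>M l i\<bar> \<le> 1" "\<And>l. r \<le> l \<Longrightarrow> l < j \<Longrightarrow> \<exists>i<n. M l = unit i"
    for r M
    using that
  proof (induction r arbitrary: M)
    case 0
    then obtain c where c: "\<And>l. l < j \<Longrightarrow> c l < n \<and> M l = unit (c l)" by (metis le0)
    have "Lmap n j M = Lmap n j (\<lambda>l. unit (c l))" using c by (auto simp: Lmap_def fun_eq_iff)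
    then have "image_vol n j M A = image_vol n j (\<lambda>l. unit (c l)) A" by (simp add: image_vol_def)
    then show ?case using units[of c] c by simp
  next
    case (Suc r)
    then have r: "r < j" by simp
    have "image_vol n j M A \<le> of_nat (4 ^ (N * n)) * (2 * (\<Sum>i<n. image_vol n j (M(r := unit i)) A))"
      by (intro image_vol_replace_row A r fin N) (use Suc.prems(2) r in auto)
    also have "\<dots> \<le> of_nat (4 ^ (N * n)) * (2 * (\<Sum>i<n. ?C ^ r * K))"
    proof (intro mult_left_mono sum_mono Suc.IH)
      fix i l assume i: "i \<in> {..<n}"
      show "r \<le> j" using r by simp
      show "\<bar>(M(r := unit i)) l k\<bar> \<le> 1" if "l < j" "k < n" for k
        using Suc.prems(2)[OF that] by (simp add: unit_def)
      show "\<exists>k<n. (M(r := unit i)) l = unit k" if "r \<le> l" "l < j"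
        using Suc.prems(3)[of l] that i by (cases "l = r") auto
    qed auto
    also have "\<dots> = ?C ^ Suc r * K" by (simp add: mult_ac)
    finally show ?case .
  qed
  from this[of j M] M show ?thesis by auto
qed

text \<open>If an axis is repeated, the image lies in a null hyperplane. Otherwise it is, up to
  renaming, the projection of \<open>A\<close> onto a coordinate subspace, and its volume is one
  summand of \<open>V\<close>.\<close>

lemma image_vol_units_le_V:
  assumes A: "A \<in> S n" "0 < n" and j: "0 < j" and c: "\<And>l. l < j \<Longrightarrow> c l < n"
  shows "image_vol n j (\<lambda>l. unit (c l)) A \<le> V n j A"
proof (cases "inj_on c {..<j}")
  case False
  then obtain a b where ab: "a < j" "b < j" "a \<noteq> b" "c a = c b" by (auto simp: inj_on_def)
  have B: "{x :: nat \<Rightarrow> real. x a = x b} \<in> sets borel"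
    by (intro borel_closed closed_Collect_eq continuous_on_product_coordinates)
  have "interior (zero_ext {..<j} -` (Lmap n j (\<lambda>l. unit (c l)) ` A)) \<subseteq> {x. x a = x b}"
  proof
    fix x assume "x \<in> interior (zero_ext {..<j} -` (Lmap n j (\<lambda>l. unit (c l)) ` A))"
    then have "zero_ext {..<j} x \<in> Lmap n j (\<lambda>l. unit (c l)) ` A" using interior_subset by blast
    then obtain z where "zero_ext {..<j} x = Lmap n j (\<lambda>l. unit (c l)) z" by blast
    then have "zero_ext {..<j} x l = Lmap n j (\<lambda>l. unit (c l)) z l" for l by simp
    from this[of a] this[of b] show "x \<in> {x. x a = x b}"
      using ab by (simp add: zero_ext_def Lmap_def)
  qed
  then have "image_vol n j (\<lambda>l. unit (c l)) A \<le> emeasure (vol {..<j}) {x. x a = x b}"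
    unfolding image_vol_def using B by (intro emeasure_mono) auto
  then show ?thesis using emeasure_vol_diagonal[of "{..<j}" a b] ab by simp
next
  case inj: True
  let ?I = "c ` {..<j}" and ?D = "Lmap n j (\<lambda>l. unit (c l)) ` A"
  let ?O = "interior (zero_ext {..<j} -` ?D)" and ?f = "\<lambda>y :: nat \<Rightarrow> real. \<lambda>l\<in>{..<j}. y (c l)"
  let ?MI = "\<Pi>\<^sub>M i\<in>?I. (lborel :: real measure)" and ?MJ = "\<Pi>\<^sub>M l\<in>{..<j}. (lborel :: real measure)"
  have I: "?I \<subseteq> {..<n}" using c by auto
  have zeA: "zero_ext ?I ` A \<in> S n"
  proof (intro definable_image[OF A A(2)] zero_ext_Rn[OF I])
    show "polynomial_on_Rn n (\<lambda>x. zero_ext ?I x i)" if "i < n" for i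
      unfolding zero_ext_def using that by (intro polynomial_intros)
  qed
  \<comment> \<open>This is the shape required by \<open>lebesgue_PiM_of_null_frontier\<close>,
    which yields the measurability that monotonicity needs.\<close>
  have E: "(\<lambda>x. restrict x ?I) ` A = {y \<in> space ?MI. zero_ext ?I y \<in> zero_ext ?I ` A}"
  proof (intro equalityI subsetI)
    fix y assume "y \<in> {y \<in> space ?MI. zero_ext ?I y \<in> zero_ext ?I ` A}"
    then obtain x where x: "x \<in> A" "y \<in> extensional ?I" "zero_ext ?I y = zero_ext ?I x"
      by (auto simp: space_PiM PiE_def)
    have "y i = restrict x ?I i" for i
      using x(2) fun_cong[OF x(3), of i] by (cases "i \<in> ?I") (auto simp: zero_ext_def extensional_def)
    then show "y \<in> (\<lambda>x. restrict x ?I) ` A" using x(1) by blast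
  next
    fix y assume "y \<in> (\<lambda>x. restrict x ?I) ` A"
    then obtain x where x: "x \<in> A" "y = restrict x ?I" by blast
    then have "zero_ext ?I y = zero_ext ?I x" by (auto simp: zero_ext_def)
    then show "y \<in> {y \<in> space ?MI. zero_ext ?I y \<in> zero_ext ?I ` A}" using x by (auto simp: space_PiM)
  qed
  have f: "?f \<in> measurable ?MI ?MJ"
    by (intro measurable_restrict measurable_component_singleton) auto
  have pre: "{x \<in> space ?MJ. zero_ext {..<j} x \<in> ?O} \<in> sets ?MJ"
    using measurable_sets[OF measurable_zero_ext, of ?O "{..<j}"] by (simp add: vimage_def Int_def conj_commute)
  let ?B = "?f -` {x \<in> space ?MJ. zero_ext {..<j} x \<in> ?O} \<inter> space ?MI"
  have B: "?B \<in> sets ?MI" using measurable_sets[OF f pre] .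
  have "image_vol n j (\<lambda>l. unit (c l)) A = emeasure ?MJ {x \<in> space ?MJ. zero_ext {..<j} x \<in> ?O}"
    unfolding image_vol_def by (intro emeasure_vol) simp
  also have "\<dots> = emeasure (distr ?MI ?MJ ?f) {x \<in> space ?MJ. zero_ext {..<j} x \<in> ?O}"
    by (simp only: distr_PiM_lborel_reindex[OF inj finite_lessThan])
  also have "\<dots> = emeasure ?MI ?B" using emeasure_distr[OF f pre] .
  also have "\<dots> = emeasure (lebesgue_PiM ?I) ?B"
    using B by (simp add: lebesgue_PiM_def)
  also have "\<dots> \<le> emeasure (lebesgue_PiM ?I) ((\<lambda>x. restrict x ?I) ` A)"
  proof (rule emeasure_mono)
    show "(\<lambda>x. restrict x ?I) ` A \<in> sets (lebesgue_PiM ?I)"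
      unfolding E using null_frontier[OF _ I A(2) zeA] by (intro lebesgue_PiM_of_null_frontier) simp
    show "?B \<subseteq> (\<lambda>x. restrict x ?I) ` A"
    proof
      fix y assume y: "y \<in> ?B"
      then have "zero_ext {..<j} (?f y) \<in> ?O" by simp
      then have "zero_ext {..<j} (?f y) \<in> zero_ext {..<j} -` ?D" by (rule subsetD[OF interior_subset])
      then have "zero_ext {..<j} (?f y) \<in> ?D" by simp
      then obtain x where x: "x \<in> A" "zero_ext {..<j} (?f y) = Lmap n j (\<lambda>l. unit (c l)) x" by blast
      have "y (c l) = x (c l)" if "l < j" for l
        using fun_cong[OF x(2), of l] that c[OF that] by (simp add: zero_ext_def Lmap_def sum_unit)
      then have "zero_ext ?I y = zero_ext ?I x" by (auto simp: zero_ext_def fun_eq_iff)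
      then show "y \<in> (\<lambda>x. restrict x ?I) ` A" unfolding E using x(1) y by blast
    qed
  qed
  also have "\<dots> \<le> (\<Sum>I | I \<subseteq> {..<n} \<and> card I = j. emeasure (lebesgue_PiM I) ((\<lambda>x. restrict x I) ` A))"
    using I card_image[OF inj]
    by (intro member_le_sum[where f = "\<lambda>I. emeasure (lebesgue_PiM I) ((\<lambda>x. restrict x I) ` A)"]) auto
  also have "\<dots> = V n j A" using j by (simp add: V_def)
  finally show ?thesis .
qed

text \<open>The base point, the functionals and their prescribed values are packed into one
  parameter point, so that all these sets are fibers of finitely many definable families, one for
  each \<open>k\<close> and \<open>i\<close>.\<close>

lemma uniform_line_frontier:
  fixes j :: nat
  assumes Z: "Z \<in> S (m + n)" and "0 < m" "0 < n"
  shows "\<exists>N. \<forall>T\<in>Rn m. \<forall>M y k i. i < n \<longrightarrow> k < j \<longrightarrow>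
    finite (frontier ((\<lambda>x. x i) `
      {x \<in> fiber m n Z T. \<forall>l<j. l \<noteq> k \<longrightarrow> (\<Sum>i<n. M l i * x i) = y l})) \<and>
    card (frontier ((\<lambda>x. x i) `
      {x \<in> fiber m n Z T. \<forall>l<j. l \<noteq> k \<longrightarrow> (\<Sum>i<n. M l i * x i) = y l})) \<le> N"
proof -
  let ?p = "m + j * n + j"
  \<comment> \<open>The parameter \<open>t\<close> consists of the \<open>m\<close> coordinates of
    \<open>T\<close>, then the \<open>j\<close> rows of \<open>M\<close> of length \<open>n\<close>,
    then \<open>y\<close>.\<close>
  define X where "X k i t u \<longleftrightarrow> (\<exists>x\<in>Rn n. join m t x \<in> Z \<and> x i = u \<and>
    (\<forall>l\<in>{..<j} - {k}. (\<Sum>i<n. t (m + l * n + i) * x i) = t (m + j * n + l)))" for k i t and u :: real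
  have idx: "m + l * n + i < ?p" "l * n + i < j * n" "l * n + i < j * n + (j + n)" if "l < j" "i < n" for l i
  proof -
    have "Suc l * n \<le> j * n" using that by (intro mult_right_mono) auto
    then show "m + l * n + i < ?p" "l * n + i < j * n" "l * n + i < j * n + (j + n)" using that by auto
  qed
  have X: "definable (Suc ?p) (\<lambda>z. X k i (z(?p := 0)) (z ?p))" if "i < n" for k i
    unfolding X_def
  proof (intro definable_ex_Rn definable_conj definable_finite_ball definable_eq)
    show "definable (Suc ?p + n) (\<lambda>w. join m ((\<lambda>i. if i < Suc ?p then w i else 0)(?p := 0))
        (\<lambda>i. w (Suc ?p + i)) \<in> Z)"
      using assms(2,3) by (intro definable_subst[OF Z])
        (auto simp: join_def Rn_iff intro!: polynomial_if polynomial_on_Rn.intros)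
  qed (use assms that idx in \<open>auto intro!: polynomial_sum polynomial_on_Rn.mult polynomial_if
      polynomial_on_Rn.const polynomial_on_Rn.coord simp: less_Suc_eq\<close>)
  define N where "N k i = (SOME N. \<forall>t\<in>Rn ?p. finite (frontier {u. X k i t u}) \<and>
      card (frontier {u. X k i t u}) \<le> N)" for k i
  have N: "finite (frontier {u. X k i t u}) \<and> card (frontier {u. X k i t u}) \<le> N k i"
    if "i < n" "t \<in> Rn ?p" for k i t
    using someI_ex[OF uniform_frontier[OF X[OF that(1)]], of k] that(2) unfolding N_def by blast
  \<comment> \<open>Summing the finitely many bounds gives one that is valid for every
    \<open>k\<close> and \<open>i\<close>.\<close>
  let ?N = "\<Sum>k<j. \<Sum>i<n. N k i"
  have "finite (frontier P) \<and> card (frontier P) \<le> ?N"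
    if T: "T \<in> Rn m" and i: "i < n" and k: "k < j"
      and P: "P = (\<lambda>x. x i) ` {x \<in> fiber m n Z T. \<forall>l<j. l \<noteq> k \<longrightarrow> (\<Sum>i<n. M l i * x i) = y l}"
    for T M y k i P
  proof -
    define t where "t a = (if a < m then T a else if a < m + j * n then M ((a - m) div n) ((a - m) mod n)
      else if a < ?p then y (a - m - j * n) else 0)" for a
    have t: "t \<in> Rn ?p" by (simp add: t_def Rn_iff)
    have "join m t x = join m T x" for x by (auto simp: join_def t_def)
    moreover have "t (m + l * n + i) = M l i" if "l < j" "i < n" for l i
      using idx[OF that] that by (simp add: t_def)
    moreover have "t (m + j * n + l) = y l" if "l < j" for l
      using that by (simp add: t_def)
    ultimately have "{u. X k i t u} = P"
      unfolding P X_def fiber_def by auto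
    moreover have "N k i \<le> ?N"
    proof -
      have "N k i \<le> (\<Sum>i<n. N k i)" using i by (intro member_le_sum) auto
      also have "\<dots> \<le> ?N" using k by (intro member_le_sum[where f = "\<lambda>k. \<Sum>i<n. N k i"]) auto
      finally show ?thesis .
    qed
    ultimately show ?thesis using N[OF i t, of k] by auto
  qed
  then show ?thesis by blast
qed

end

section \<open>Projections to linear subspaces\<close>

lemma inner_Rn_add_left: "inner_Rn n (x + y) z = inner_Rn n x z + inner_Rn n y z"
  by (simp add: inner_Rn_def distrib_right sum.distrib)

lemma inner_Rn_diff_left: "inner_Rn n (x - y) z = inner_Rn n x z - inner_Rn n y z"
  by (simp add: inner_Rn_def left_diff_distrib sum_subtractf)

lemma inner_Rn_scaleR_left: "inner_Rn n (c *\<^sub>R x) z = c * inner_Rn n x z"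
  by (simp add: inner_Rn_def scaleR_fun_def sum_distrib_left mult_ac)

lemma inner_Rn_commute: "inner_Rn n x y = inner_Rn n y x"
  by (simp add: inner_Rn_def mult.commute)

lemma inner_Rn_zero_left: "inner_Rn n 0 z = 0"
  by (simp add: inner_Rn_def)

lemma inner_Rn_sum_left: "inner_Rn n (\<Sum>k\<in>I. f k) z = (\<Sum>k\<in>I. inner_Rn n (f k) z)"
  by (induction I rule: infinite_finite_induct)
    (simp_all only: sum.infinite sum.empty sum.insert inner_Rn_zero_left inner_Rn_add_left
      not_False_eq_True)

lemmas inner_Rn_left = inner_Rn_add_left inner_Rn_diff_left inner_Rn_scaleR_left
  inner_Rn_zero_left inner_Rn_sum_left

lemma inner_Rn_self_eq_0: "x \<in> Rn n \<Longrightarrow> inner_Rn n x x = 0 \<Longrightarrow> x = 0"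
proof
  fix i assume x: "x \<in> Rn n" "inner_Rn n x x = 0"
  then have "\<forall>i\<in>{..<n}. x i * x i = 0"
    unfolding inner_Rn_def by (subst sum_nonneg_eq_0_iff[symmetric]) auto
  then show "x i = 0 i" using x(1) by (cases "i < n") (auto simp: Rn_iff)
qed

lemma inner_Rn_self_nonneg: "0 \<le> inner_Rn n x x"
  by (simp add: inner_Rn_def sum_nonneg)

lemma subspace_Rn: "subspace (Rn n)"
  by (auto simp: subspace_def Rn_iff scaleR_fun_def)

text \<open>The residual is orthogonal to every \<open>b l\<close>, and being orthogonal to it is a
  linear condition.\<close>

lemma orthonormal_expansion:
  fixes b :: "nat \<Rightarrow> nat \<Rightarrow> real"
  assumes b: "\<forall>k<d. \<forall>l<d. inner_Rn n (b k) (b l) = (if k = l then 1 else 0)"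
    and w: "w \<in> span (b ` {..<d})"
  shows "inner_Rn n (x - (\<Sum>k<d. inner_Rn n x (b k) *\<^sub>R b k)) w = 0"
proof -
  let ?y = "x - (\<Sum>k<d. inner_Rn n x (b k) *\<^sub>R b k)"
  have *: "inner_Rn n ?y (b l) = 0" if "l < d" for l
  proof -
    have "(\<Sum>k<d. inner_Rn n x (b k) * inner_Rn n (b k) (b l)) = (\<Sum>k<d. if k = l then inner_Rn n x (b k) else 0)"
      using b that by (intro sum.cong) auto
    also have "\<dots> = inner_Rn n x (b l)" using that by simp
    finally show ?thesis by (simp add: inner_Rn_left)
  qed
  have "subspace {w. inner_Rn n w ?y = 0}"
    by (auto simp: subspace_def inner_Rn_left)
  then have "span (b ` {..<d}) \<subseteq> {w. inner_Rn n w ?y = 0}"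
    using * by (intro span_minimal) (auto simp: inner_Rn_commute[of n _ ?y])
  then show ?thesis using w by (auto simp: inner_Rn_commute[of n _ ?y])
qed

lemma Gram_Schmidt_Rn:
  fixes v :: "nat \<Rightarrow> nat \<Rightarrow> real"
  assumes "inj_on v {..<d}" "independent (v ` {..<d})" "v ` {..<d} \<subseteq> Rn n"
  shows "\<exists>b. (\<forall>k<d. \<forall>l<d. inner_Rn n (b k) (b l) = (if k = l then 1 else 0)) \<and>
    span (b ` {..<d}) = span (v ` {..<d})"
  using assms
proof (induction d)
  case 0
  then show ?case by simp
next
  case (Suc d)
  let ?v = "v ` {..<d}"
  have ins: "v ` {..<Suc d} = insert (v d) ?v" by (simp add: lessThan_Suc)
  have "v d \<notin> ?v" using Suc.prems(1) by (auto simp: inj_on_def) (metis lessThan_iff lessI less_Suc_eq less_irrefl)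
  then have v: "independent ?v" "v d \<notin> span ?v"
    using Suc.prems(2) by (auto simp: ins independent_insert)
  obtain b where b: "\<forall>k<d. \<forall>l<d. inner_Rn n (b k) (b l) = (if k = l then 1 else 0)"
      "span (b ` {..<d}) = span ?v"
    using Suc.IH v(1) Suc.prems by (auto simp: ins inj_on_def)
  define s where "s = (\<Sum>k<d. inner_Rn n (v d) (b k) *\<^sub>R b k)"
  define y where "y = v d - s"
  have s: "s \<in> span (b ` {..<d})"
    unfolding s_def by (intro span_sum span_scale span_base) auto
  have sR: "span (v ` {..<Suc d}) \<subseteq> Rn n"
    using Suc.prems(3) subspace_Rn by (intro span_minimal)
  have "s \<in> span (v ` {..<Suc d})"
    using s b(2) span_mono[of ?v "v ` {..<Suc d}"] unfolding ins by blast
  then have y_span: "y \<in> span (v ` {..<Suc d})"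
    unfolding y_def by (intro span_diff span_base[of "v d"]) auto
  have "y \<noteq> 0" using s b(2) v(2) by (auto simp: y_def)
  \<comment> \<open>\<open>inner_Rn n\<close> sees only the first \<open>n\<close> coordinates and
    is definite only on \<open>Rn n\<close>, hence the detour through the span.\<close>
  then have yy: "0 < inner_Rn n y y"
    using inner_Rn_self_eq_0[of y n] y_span sR inner_Rn_self_nonneg[of n y] by (auto simp: less_le)
  define c where "c = sqrt (inner_Rn n y y)"
  have c: "c > 0" "c * c = inner_Rn n y y" using yy by (simp_all add: c_def)
  define e where "e = (1 / c) *\<^sub>R y"
  have y_orth: "inner_Rn n y (b l) = 0" if "l < d" for l
    unfolding y_def s_def using that by (intro orthonormal_expansion[OF b(1)] span_base) auto
  have "inner_Rn n e e = 1"
    using c yy inner_Rn_commute[of n y e] by (simp add: e_def inner_Rn_scaleR_left)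
  moreover have e_b: "inner_Rn n e (b l) = 0" if "l < d" for l
    using y_orth[OF that] by (simp add: e_def inner_Rn_scaleR_left)
  moreover have "inner_Rn n (b l) e = 0" if "l < d" for l
    using e_b[OF that] by (simp add: inner_Rn_commute)
  ultimately have e: "inner_Rn n e e = 1" "\<And>l. l < d \<Longrightarrow> inner_Rn n e (b l) = 0"
    "\<And>l. l < d \<Longrightarrow> inner_Rn n (b l) e = 0" by blast+
  have b': "(b(d := e)) ` {..<Suc d} = insert e (b ` {..<d})"
    by (auto simp: lessThan_Suc)
  have "span (insert e (b ` {..<d})) = span (insert (v d) ?v)"
    unfolding span_eq
  proof (intro conjI insert_subsetI)
    show "e \<in> span (insert (v d) ?v)"
      using y_span unfolding e_def ins by (rule span_scale)
    show "b ` {..<d} \<subseteq> span (insert (v d) ?v)"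
      using b(2) span_superset[of "b ` {..<d}"] span_mono[of ?v "insert (v d) ?v"] by auto
    have "v d = c *\<^sub>R e + s" using c(1) by (simp add: e_def y_def)
    moreover have "s \<in> span (insert e (b ` {..<d}))"
      using s span_mono[of "b ` {..<d}" "insert e (b ` {..<d})"] by auto
    ultimately show "v d \<in> span (insert e (b ` {..<d}))"
      by (metis insertI1 span_add span_base span_scale)
    show "?v \<subseteq> span (insert e (b ` {..<d}))"
      using b(2) span_superset[of ?v] span_mono[of "b ` {..<d}" "insert e (b ` {..<d})"] by auto
  qed
  then have "span ((b(d := e)) ` {..<Suc d}) = span (v ` {..<Suc d})"
    by (simp only: b' ins)
  moreover have "\<forall>k<Suc d. \<forall>l<Suc d.
      inner_Rn n ((b(d := e)) k) ((b(d := e)) l) = (if k = l then 1 else 0)"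
    using b(1) e by (auto simp: less_Suc_eq)
  ultimately show ?case by blast
qed

lemma exists_orthonormal_basis:
  assumes "W \<subseteq> Rn n" "subspace W" "0 < dim W"
  shows "\<exists>b. orthonormal_basis n W b"
proof -
  obtain B where B: "B \<subseteq> W" "independent B" "W \<subseteq> span B" "card B = dim W"
    using basis_exists[of W] by blast
  \<comment> \<open>An infinite basis would have cardinality 0, contrary to positive
    dimension.\<close>
  then have fin: "finite B" using assms(3) by (metis card.infinite less_irrefl)
  then obtain v where v: "bij_betw v {..<dim W} B"
    using ex_bij_betw_nat_finite[OF fin] B(4) by (auto simp: atLeast0LessThan)
  have span: "span B = W" using B assms(2) by (simp add: span_minimal subset_antisym)
  have "inj_on v {..<dim W}" "v ` {..<dim W} = B" using v by (auto simp: bij_betw_def)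
  with Gram_Schmidt_Rn[of v "dim W" n] B assms(1) span show ?thesis
    unfolding orthonormal_basis_def by auto
qed

text \<open>A unit vector has components of modulus at most 1, as the replacement of rows
  requires.\<close>

lemma orthonormal_basis_component_le:
  assumes "orthonormal_basis n W b" "k < dim W" "i < n"
  shows "\<bar>b k i\<bar> \<le> 1"
proof -
  have "b k i * b k i \<le> inner_Rn n (b k) (b k)"
    unfolding inner_Rn_def using assms(3) by (intro member_le_sum[where f = "\<lambda>i. b k i * b k i"]) auto
  then have "(b k i)\<^sup>2 \<le> 1"
    using assms by (simp add: orthonormal_basis_def power2_eq_square)
  then show ?thesis by (simp add: abs_square_le_1)
qed

text \<open>The expansion in \<open>b\<close> is the unique candidate for the projection. Thus
  projecting to \<open>W\<close> and passing to coordinates is the linear map whose rows are the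
  vectors of \<open>b\<close>.\<close>

lemma inner_orth_proj:
  assumes W: "W \<subseteq> Rn n" "subspace W" and b: "orthonormal_basis n W b" and "k < dim W"
  shows "inner_Rn n (orth_proj n W x) (b k) = inner_Rn n x (b k)"
proof -
  have o: "\<forall>k<dim W. \<forall>l<dim W. inner_Rn n (b k) (b l) = (if k = l then 1 else 0)"
    and sp: "span (b ` {..<dim W}) = W"
    using b by (auto simp: orthonormal_basis_def)
  define y where "y = (\<Sum>k<dim W. inner_Rn n x (b k) *\<^sub>R b k)"
  have "y \<in> span (b ` {..<dim W})"
    unfolding y_def by (intro span_sum span_scale span_base) auto
  then have y: "y \<in> W" "\<forall>w\<in>W. inner_Rn n (x - y) w = 0"
    using orthonormal_expansion[OF o] sp by (auto simp: y_def)
  have "orth_proj n W x = y"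
    unfolding orth_proj_def
  proof (rule the_equality)
    fix z assume z: "z \<in> W \<and> (\<forall>w\<in>W. inner_Rn n (x - z) w = 0)"
    \<comment> \<open>The difference of two candidates lies in \<open>W\<close> and is orthogonal to
      \<open>W\<close>, hence to itself.\<close>
    have zy: "z - y \<in> W" using z y W(2) by (simp add: subspace_diff)
    then have "inner_Rn n (x - y) (z - y) - inner_Rn n (x - z) (z - y) = 0" using z y by simp
    then have "inner_Rn n (z - y) (z - y) = 0" by (simp add: inner_Rn_diff_left)
    then have "z - y = 0" using inner_Rn_self_eq_0 zy W(1) by blast
    then show "z = y" by simp
  qed (use y in simp)
  moreover have "b k \<in> span (b ` {..<dim W})" using assms(4) by (intro span_base) simp
  then have "b k \<in> W" unfolding sp .
  ultimately show ?thesis using y(2) by (simp add: inner_Rn_diff_left)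
qed

section \<open>Closures and volumes of projections\<close>

lemma continuous_on_Lmap: "continuous_on A (Lmap n j M)"
  unfolding Lmap_def
proof (intro continuous_on_coordinatewise_then_product)
  show "continuous_on A (\<lambda>x. if k < j then \<Sum>i<n. M k i * x i else 0)" for k
    by (cases "k < j") (auto intro!: continuous_intros
        continuous_on_subset[OF continuous_on_product_coordinates])
qed

lemma closure_of_Euclidean_space_subset: "Euclidean_space n closure_of A \<subseteq> closure A"
  using closure_of_subtopology_subset[of "powertop_real UNIV"]
  by (simp add: Euclidean_space_def euclidean_product_topology)

context semialgebraic_o_minimal
begin

text \<open>The closure is absorbed here: by continuity the projection of the closure lies in the
  closure of the projection, and a null frontier makes the latter no larger in volume than the
  interior.\<close>

lemma subspace_volume_le_image_vol:
  assumes A: "A \<in> S n" "0 < n" and W: "W \<subseteq> Rn n" "subspace W" "0 < dim W"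
  defines "b \<equiv> SOME b. orthonormal_basis n W b"
  shows "subspace_volume n W (orth_proj n W ` (Euclidean_space n closure_of A)) \<le> image_vol n (dim W) b A"
proof -
  let ?J = "{..<dim W}"
  let ?M = "\<Pi>\<^sub>M k\<in>?J. (lborel :: real measure)"
  let ?C = "closure (zero_ext ?J -` (Lmap n (dim W) b ` A))"
  have b: "orthonormal_basis n W b"
    unfolding b_def by (rule someI_ex[OF exists_orthonormal_basis[OF W]])
  have pre: "{y \<in> space ?M. zero_ext ?J y \<in> ?C} \<in> sets ?M"
    using measurable_sets[OF measurable_zero_ext, of ?C ?J] by (simp add: vimage_def Int_def conj_commute)
  have "zero_ext ?J (Lmap n (dim W) b x) = Lmap n (dim W) b x" for x
    by (auto simp: zero_ext_def Lmap_def)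
  then have "Lmap n (dim W) b ` A \<subseteq> zero_ext ?J -` (Lmap n (dim W) b ` A)" by auto
  then have "Lmap n (dim W) b ` closure A \<subseteq> ?C"
    using closure_subset
    by (intro image_closure_subset continuous_on_Lmap closed_closure) (rule order_trans)
  then have C: "Lmap n (dim W) b x \<in> ?C" if "x \<in> Euclidean_space n closure_of A" for x
    using that closure_of_Euclidean_space_subset by blast
  have "(\<lambda>y. \<lambda>k\<in>?J. inner_Rn n y (b k)) ` orth_proj n W ` (Euclidean_space n closure_of A) \<subseteq>
      {y \<in> space ?M. zero_ext ?J y \<in> ?C}"
  proof clarify
    fix x assume x: "x \<in> Euclidean_space n closure_of A"
    have "zero_ext ?J (\<lambda>k\<in>?J. inner_Rn n (orth_proj n W x) (b k)) = Lmap n (dim W) b x"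
      using inner_orth_proj[OF W(1,2) b]
      by (auto simp: zero_ext_def Lmap_def inner_Rn_def fun_eq_iff mult.commute)
    then show "(\<lambda>k\<in>?J. inner_Rn n (orth_proj n W x) (b k)) \<in> space ?M \<and>
        zero_ext ?J (\<lambda>k\<in>?J. inner_Rn n (orth_proj n W x) (b k)) \<in> ?C"
      using C[OF x] by (simp add: space_PiM)
  qed
  then have "subspace_volume n W (orth_proj n W ` (Euclidean_space n closure_of A)) \<le>
      emeasure (lebesgue_PiM ?J) {y \<in> space ?M. zero_ext ?J y \<in> ?C}"
    unfolding subspace_volume_def Let_def b_def[symmetric] lebesgue_PiM_def
    using pre by (intro emeasure_mono) auto
  also have "\<dots> = emeasure (vol ?J) ?C"
    using pre by (simp add: lebesgue_PiM_def emeasure_vol)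
  also have "\<dots> = image_vol n (dim W) b A"
    using A W(3) by (simp add: image_vol_eq_closure)
  finally show ?thesis .
qed

lemma fiber_definable:
  assumes "Z \<in> S (m + n)" "0 < n"
  shows "fiber m n Z T \<in> S n"
proof -
  have "definable n (\<lambda>x. join m T x \<in> Z)"
    using assms(2) by (intro definable_subst[OF assms(1)])
      (auto simp: join_def Rn_iff intro!: polynomial_if polynomial_on_Rn.intros)
  then show ?thesis by (simp add: definable_def fiber_def)
qed

end

section \<open>Comparison of the two kinds of projection volume\<close>

theorem proposition6p1:
  fixes S :: "nat \<Rightarrow> (nat \<Rightarrow> real) set set"
    and m n j :: nat
    and Z :: "(nat \<Rightarrow> real) set"
  assumes "o_minimal_structure S"
    and "\<And>k A. k \<ge> 1 \<Longrightarrow> semialgebraic k A \<Longrightarrow> A \<in> S k"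
    and "m > 0" and "n > 0"
    and "Z \<in> S (m + n)"
    and "\<And>T. T \<in> Rn m \<Longrightarrow> bounded_Rn n (fiber m n Z T)"
    and "j \<le> n - 1"
  shows "\<exists>B::real. \<forall>T\<in>Rn m.
    V' n j (Euclidean_space n closure_of (fiber m n Z T)) \<le> ennreal B * V n j (fiber m n Z T)"
proof (cases "j = 0")
  case True
  then show ?thesis by (intro exI[of _ 1]) (simp add: V_def V'_def)
next
  case False
  interpret semialgebraic_o_minimal S
    using assms(1,2) by (simp add: semialgebraic_o_minimal_def semialgebraic_o_minimal_axioms_def)
  obtain N where N: "\<And>T M y k i. T \<in> Rn m \<Longrightarrow> i < n \<Longrightarrow> k < j \<Longrightarrow>
      finite (frontier ((\<lambda>x. x i) `
        {x \<in> fiber m n Z T. \<forall>l<j. l \<noteq> k \<longrightarrow> (\<Sum>i<n. M l i * x i) = y l})) \<and>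
      card (frontier ((\<lambda>x. x i) `
        {x \<in> fiber m n Z T. \<forall>l<j. l \<noteq> k \<longrightarrow> (\<Sum>i<n. M l i * x i) = y l})) \<le> N"
    using uniform_line_frontier[OF assms(5,3,4), of j] by blast
  \<comment> \<open>One factor for each of the \<open>j\<close> replaced rows; \<open>N\<close> was
    obtained before \<open>T\<close> and \<open>W\<close>, so the constant is uniform in
    both.\<close>
  define C where "C = (4 ^ (N * n) * 2 * n) ^ j"
  have "V' n j (Euclidean_space n closure_of A) \<le> ennreal (real C) * V n j A"
    if T: "T \<in> Rn m" and A: "A = fiber m n Z T" for T A
  proof -
    have AS: "A \<in> S n" unfolding A by (rule fiber_definable[OF assms(5,4)])
    have "subspace_volume n W (orth_proj n W ` (Euclidean_space n closure_of A)) \<le> of_nat C * V n j A"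
      if W: "W \<subseteq> Rn n" "subspace W" "dim W = j" for W
    proof -
      define b where "b = (SOME b. orthonormal_basis n W b)"
      have b: "orthonormal_basis n W b"
        unfolding b_def using W False by (intro someI_ex[OF exists_orthonormal_basis]) auto
      have "subspace_volume n W (orth_proj n W ` (Euclidean_space n closure_of A)) \<le> image_vol n j b A"
        using subspace_volume_le_image_vol[OF AS assms(4) W(1,2)] W(3) False by (simp add: b_def)
      also have "\<dots> \<le> of_nat (4 ^ (N * n) * 2 * n) ^ j * V n j A"
        using N[OF T] W(3) orthonormal_basis_component_le[OF b] False
        by (intro image_vol_le_units AS assms(4) image_vol_units_le_V) (auto simp: A)
      finally show ?thesis by (simp add: C_def)
    qed
    then show ?thesis
      using False unfolding V'_def by (auto intro!: SUP_least simp: ennreal_of_nat_eq_real_of_nat)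
  qed
  then show ?thesis by blast
qed

end
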